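(* Let $K$ be a function field over $\mathbb{F}_q$ with a rational place $\infty$, where $\mathrm{char}(\mathbb{F}_q)=2$, let $A$ be the ring of elements of $K$ regular outside $\infty$, and let $v$ be a monic prime of $A$. Let $n\ge 1$, let $k_1,\dots,k_n\ge 1$ be integers, and let $s_1,\dots,s_n$ be $q$-even integers such that the integers in the collection $\{s_1,\dots,s_n\}\cup\{2s_i: k_i>1\}$ are pairwise distinct. Put $\phi:=\sum_{i=1}^n k_i$, $\mathbf{s}_0:=((s_1)_{k_1},\dots,(s_n)_{k_n})$, and for each $i$ with $k_i>1$ let $\mathbf{s}_i$ be the tuple obtained from $\mathbf{s}_0$ by replacing two of the copies of $s_i$ by a single entry $2s_i$, i.e. $\mathbf{s}_i:=((s_1)_{k_1},\dots,(s_i)_{k_i-2},2s_i,\dots,(s_n)_{k_n})$. Then $$\sum_{i:\,k_i>1}\ \sum_{\mathbf{t}\in \mathbf{L}_i}\zeta_v(\mathbf{t})\;+\;\phi\sum_{\mathbf{t}\in\mathbf{L}_0}\zeta_v(\mathbf{t})=0,$$ where $\mathbf{L}_i$ is the set of all distinct re-orderings of the tuple $\mathbf{s}_i$ (for $i=0$ and for each $i$ with $k_i>1$), and $\phi$ is viewed as an element of $\mathbb{F}_q$.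
   Context: $(a)_j$ denotes a list of $j$ copies of $a$. An integer $s$ is called $q$-even if $(q-1)\mid s$. A sign function on $K_\infty$ is fixed, so that "monic" makes sense; $A_{d+}$ denotes the set of monic elements of $A$ of degree $d$. For a monic prime $v$ of $A$, $K_v$ is the completion of $K$ at $v$, and for $k\in\mathbb{Z}$, $d\ge0$, $\widetilde{S}_d(k):=\sum_{a\in A_{d+},\,(a,v)=1}a^{-k}\in K$. For $\mathbf{s}=(s_1,\dots,s_r)\in\mathbb{Z}^r$, $\zeta_v(\mathbf{s}):=\sum_{d_1>\cdots>d_r\ge 0}\widetilde{S}_{d_1}(s_1)\cdots\widetilde{S}_{d_r}(s_r)\in K_v$ (convergent for all integer $s_i$). *)

theory Defs
  imports
    "HOL-Analysis.Analysis"
    "HOL-Computational_Algebra.Computational_Algebra"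
    "HOL-Combinatorics.Multiset_Permutations"
begin

text \<open>
  The function field \<open>K\<close> is the whole type \<open>'k\<close>; its constant field is a subset \<open>F\<close> of \<open>'k\<close>.
\<close>

definition is_subfield :: "'k::field set \<Rightarrow> bool" where
  "is_subfield F \<longleftrightarrow> 0 \<in> F \<and> 1 \<in> F \<and>
     (\<forall>x\<in>F. \<forall>y\<in>F. x - y \<in> F \<and> x * y \<in> F) \<and> (\<forall>x\<in>F. inverse x \<in> F)"

definition polys_over :: "'k::field set \<Rightarrow> 'k poly set" where
  "polys_over F = {p. \<forall>i. coeff p i \<in> F}"

definition transcendental_over :: "'k::field set \<Rightarrow> 'k \<Rightarrow> bool" where
  "transcendental_over F t \<longleftrightarrow> (\<forall>p\<in>polys_over F. poly p t = 0 \<longrightarrow> p = 0)"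

definition rational_functions :: "'k::field set \<Rightarrow> 'k \<Rightarrow> 'k set" where
  "rational_functions F t =
     {poly p t / poly r t | p r. p \<in> polys_over F \<and> r \<in> polys_over F \<and> poly r t \<noteq> 0}"

definition finite_over :: "'k::field set \<Rightarrow> bool" where
  "finite_over E \<longleftrightarrow> (\<exists>B. finite B \<and> (\<forall>x. \<exists>c. (\<forall>b\<in>B. c b \<in> E) \<and> x = (\<Sum>b\<in>B. c b * b)))"

definition function_field :: "'k::field set \<Rightarrow> bool" where
  "function_field F \<longleftrightarrow> is_subfield F \<and>
     (\<exists>t. transcendental_over F t \<and> finite_over (rational_functions F t))"

text \<open>
  A place of \<open>K/F\<close> is represented by its valuation ring, a ring \<open>R\<close> with \<open>F \<subset> R \<subset> K\<close>
  containing \<open>x\<close> or \<open>1/x\<close> for every \<open>x\<close>.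
\<close>

definition place :: "'k::field set \<Rightarrow> 'k set \<Rightarrow> bool" where
  "place F R \<longleftrightarrow> F \<subset> R \<and> R \<subset> UNIV \<and>
     (\<forall>x\<in>R. \<forall>y\<in>R. x - y \<in> R \<and> x * y \<in> R) \<and> (\<forall>x. x \<in> R \<or> inverse x \<in> R)"

definition maximal_ideal_of :: "'k::field set \<Rightarrow> 'k set" where
  "maximal_ideal_of R = {x\<in>R. x = 0 \<or> inverse x \<notin> R}"

text \<open>Rational: the residue field \<open>R/m\<close> is \<open>F\<close>.\<close>

definition rational_place :: "'k::field set \<Rightarrow> 'k set \<Rightarrow> bool" where
  "rational_place F R \<longleftrightarrow> place F R \<and> (\<forall>x\<in>R. \<exists>c\<in>F. x - c \<in> maximal_ideal_of R)"

text \<open>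
  \<open>w\<close> is the normalized discrete valuation with valuation ring \<open>R\<close>. Since \<open>w\<close> has values in
  \<open>int\<close>, the value \<open>w 0\<close> is meaningless and is never used.
\<close>

definition normalized_valuation :: "'k::field set \<Rightarrow> ('k \<Rightarrow> int) \<Rightarrow> bool" where
  "normalized_valuation R w \<longleftrightarrow>
     (\<forall>x y. x \<noteq> 0 \<longrightarrow> y \<noteq> 0 \<longrightarrow> w (x * y) = w x + w y) \<and>
     (\<forall>x y. x \<noteq> 0 \<longrightarrow> y \<noteq> 0 \<longrightarrow> x + y \<noteq> 0 \<longrightarrow> min (w x) (w y) \<le> w (x + y)) \<and>
     (\<exists>x. x \<noteq> 0 \<and> w x = 1) \<and>
     R = {x. x = 0 \<or> 0 \<le> w x}"

text \<open>
  \<open>\<iota>\<close> exhibits the type \<open>'l\<close> as the completion of \<open>K\<close> for the valuation \<open>w\<close>: \<open>'l\<close> is a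
  complete field for the absolute value \<open>dist x 0\<close> (completeness is part of the class), in which
  \<open>K\<close> is dense, and on \<open>K\<close> this absolute value is \<open>c\<close> to the power \<open>- w x\<close> for some \<open>c > 1\<close>.
\<close>

definition is_completion ::
    "('k::field \<Rightarrow> int) \<Rightarrow> ('k \<Rightarrow> 'l::{field,complete_space}) \<Rightarrow> bool" where
  "is_completion w \<iota> \<longleftrightarrow>
     \<iota> 1 = 1 \<and> (\<forall>x y. \<iota> (x + y) = \<iota> x + \<iota> y) \<and> (\<forall>x y. \<iota> (x * y) = \<iota> x * \<iota> y) \<and>
     (\<forall>x y z :: 'l. dist (x + z) (y + z) = dist x y) \<and>
     (\<forall>x y :: 'l. dist (x * y) 0 = dist x 0 * dist y 0) \<and>
     (\<exists>c>1. \<forall>x. x \<noteq> 0 \<longrightarrow> dist (\<iota> x) 0 = c powi (- w x)) \<and>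
     closure (range \<iota>) = UNIV"

text \<open>The ring \<open>A\<close> of elements regular outside the place \<open>R\<close>.\<close>

definition regular_outside :: "'k::field set \<Rightarrow> 'k set \<Rightarrow> 'k set" where
  "regular_outside F R = \<Inter> {R'. place F R' \<and> R' \<noteq> R}"

definition dvd_in :: "'k::field set \<Rightarrow> 'k \<Rightarrow> 'k \<Rightarrow> bool" where
  "dvd_in A x y \<longleftrightarrow> (\<exists>z\<in>A. y = x * z)"

definition prime_in :: "'k::field set \<Rightarrow> 'k \<Rightarrow> bool" where
  "prime_in A v \<longleftrightarrow> v \<in> A \<and> v \<noteq> 0 \<and> \<not> dvd_in A v 1 \<and>
     (\<forall>a\<in>A. \<forall>b\<in>A. dvd_in A v (a * b) \<longrightarrow> dvd_in A v a \<or> dvd_in A v b)"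

definition coprime_in :: "'k::field set \<Rightarrow> 'k \<Rightarrow> 'k \<Rightarrow> bool" where
  "coprime_in A a b \<longleftrightarrow> (\<exists>x\<in>A. \<exists>y\<in>A. x * a + y * b = 1)"

text \<open>The localization of \<open>A\<close> at the prime ideal \<open>vA\<close>, which is the valuation ring of the place \<open>v\<close>.\<close>

definition localization_at :: "'k::field set \<Rightarrow> 'k \<Rightarrow> 'k set" where
  "localization_at A v = {a / b | a b. a \<in> A \<and> b \<in> A \<and> \<not> dvd_in A v b}"

text \<open>
  A sign function: a homomorphism from the unit group of \<open>K\<^sub>\<infinity>\<close> to that of \<open>F\<close> which is the
  identity on the units of \<open>F\<close>; here \<open>\<iota>\<close> is the embedding of \<open>K\<close> into \<open>K\<^sub>\<infinity>\<close>.
\<close>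

definition sign_function :: "'k::field set \<Rightarrow> ('k \<Rightarrow> 'm::field) \<Rightarrow> ('m \<Rightarrow> 'k) \<Rightarrow> bool" where
  "sign_function F \<iota> sg \<longleftrightarrow>
     (\<forall>x. x \<noteq> 0 \<longrightarrow> sg x \<in> F - {0}) \<and>
     (\<forall>x y. x \<noteq> 0 \<longrightarrow> y \<noteq> 0 \<longrightarrow> sg (x * y) = sg x * sg y) \<and>
     (\<forall>c\<in>F - {0}. sg (\<iota> c) = c)"

definition monic_elt :: "('k::field \<Rightarrow> 'm::field) \<Rightarrow> ('m \<Rightarrow> 'k) \<Rightarrow> 'k \<Rightarrow> bool" where
  "monic_elt \<iota> sg a \<longleftrightarrow> a \<noteq> 0 \<and> sg (\<iota> a) = 1"

text \<open>
  The monic elements of \<open>A\<close> of degree \<open>d\<close>. As the place at infinity is rational, the degree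
  of \<open>a\<close> is minus its valuation \<open>w a\<close> there.
\<close>

definition monics_of_degree ::
    "'k::field set \<Rightarrow> ('k \<Rightarrow> int) \<Rightarrow> ('k \<Rightarrow> 'm::field) \<Rightarrow> ('m \<Rightarrow> 'k) \<Rightarrow> nat \<Rightarrow> 'k set" where
  "monics_of_degree A w \<iota> sg d = {a\<in>A. monic_elt \<iota> sg a \<and> - w a = int d}"

definition S_tilde ::
    "'k::field set \<Rightarrow> ('k \<Rightarrow> int) \<Rightarrow> ('k \<Rightarrow> 'm::field) \<Rightarrow> ('m \<Rightarrow> 'k) \<Rightarrow> 'k \<Rightarrow> nat \<Rightarrow> int \<Rightarrow> 'k" where
  "S_tilde A w \<iota> sg v d k =
     (\<Sum>a\<in>{a \<in> monics_of_degree A w \<iota> sg d. coprime_in A a v}. a powi (- k))"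

text \<open>
  \<open>S d s\<close> is the power sum of degree \<open>d\<close> and exponent \<open>s\<close>, \<open>\<iota>\<close> the embedding of \<open>K\<close> into its
  completion; the sum is over all strictly decreasing sequences of degrees.
\<close>

definition multizeta ::
    "('k \<Rightarrow> 'l::{field,complete_space}) \<Rightarrow> (nat \<Rightarrow> int \<Rightarrow> 'k) \<Rightarrow> int list \<Rightarrow> 'l" where
  "multizeta \<iota> S s =
     (\<Sum>\<^sub>\<infinity>d\<in>{d. length d = length s \<and> sorted_wrt (>) d}. \<Prod>j<length s. \<iota> (S (d ! j) (s ! j)))"

definition base_tuple :: "nat \<Rightarrow> (nat \<Rightarrow> nat) \<Rightarrow> (nat \<Rightarrow> int) \<Rightarrow> int list" where
  "base_tuple n k s = concat (map (\<lambda>j. replicate (k j) (s j)) [1..<Suc n])"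

definition merged_tuple :: "nat \<Rightarrow> (nat \<Rightarrow> nat) \<Rightarrow> (nat \<Rightarrow> int) \<Rightarrow> nat \<Rightarrow> int list" where
  "merged_tuple n k s i = concat (map
     (\<lambda>j. if j = i then replicate (k j - 2) (s j) @ [2 * s j] else replicate (k j) (s j))
     [1..<Suc n])"

definition reorderings :: "'a list \<Rightarrow> 'a list set" where
  "reorderings t = permutations_of_multiset (mset t)"

end

theory Submission
  imports Defs
begin

text \<open>
  Let \<open>p\<^sub>D(s)\<close> be the sum of \<open>S\<^sub>d(s)\<close> over \<open>d < D\<close>, and truncate all multizeta values to
  degrees below \<open>D\<close>. In characteristic 2 the truncated left-hand side of the relation equals
  the sum over \<open>i\<close> of \<open>p\<^sub>D(s\<^sub>i)\<close> times the symmetric sum for the multiset of exponents with one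
  \<open>s\<^sub>i\<close> removed: when the extra point collides with a point of exponent \<open>s\<^sub>j\<close>, the contributions
  cancel in pairs for \<open>j \<noteq> i\<close>, and for \<open>j = i\<close> they give \<open>S\<^sub>d(s\<^sub>i)\<^sup>2 = S\<^sub>d(2s\<^sub>i)\<close>. It remains to see that
  \<open>p\<^sub>D(s)\<close> tends to 0 for \<open>q\<close>-even \<open>s\<close>. Since \<open>q\<close> is even, \<open>p\<^sub>D(s)\<close> is also the sum of \<open>a\<^sup>-\<^sup>s\<close> over
  all \<open>a\<close>, monic or not, of degree less than \<open>D\<close> and prime to \<open>v\<close>. For large \<open>D\<close> these form a
  finite set on which \<open>a \<mapsto> a + v\<^sup>m\<close> is an involution without fixed points, so the sum is
  divisible by \<open>v\<^sup>m\<close>.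
\<close>

section \<open>Existence of valuation rings\<close>

definition subring_of :: "'k::field set \<Rightarrow> bool" where
  "subring_of R \<longleftrightarrow> 1 \<in> R \<and> (\<forall>x\<in>R. \<forall>y\<in>R. x - y \<in> R \<and> x * y \<in> R)"

lemma subring_ofD:
  assumes "subring_of R"
  shows "1 \<in> R" "0 \<in> R" "x \<in> R \<Longrightarrow> - x \<in> R"
    "x \<in> R \<Longrightarrow> y \<in> R \<Longrightarrow> x - y \<in> R"
    "x \<in> R \<Longrightarrow> y \<in> R \<Longrightarrow> x + y \<in> R" "x \<in> R \<Longrightarrow> y \<in> R \<Longrightarrow> x * y \<in> R"
proof -
  show 1: "1 \<in> R" using assms by (auto simp: subring_of_def)
  have diff: "x - y \<in> R" if "x \<in> R" "y \<in> R" for x y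
    using assms that by (auto simp: subring_of_def)
  show 0: "0 \<in> R" using diff[OF 1 1] by simp
  have minus: "- x \<in> R" if "x \<in> R" for x using diff[OF 0 that] by simp
  show "x \<in> R \<Longrightarrow> - x \<in> R" by (rule minus)
  show "x \<in> R \<Longrightarrow> y \<in> R \<Longrightarrow> x - y \<in> R" by (rule diff)
  show "x \<in> R \<Longrightarrow> y \<in> R \<Longrightarrow> x + y \<in> R" using diff[of x "- y"] minus[of y] by simp
  show "x \<in> R \<Longrightarrow> y \<in> R \<Longrightarrow> x * y \<in> R" using assms by (auto simp: subring_of_def)
qed

lemma subring_of_power: "subring_of R \<Longrightarrow> x \<in> R \<Longrightarrow> x ^ n \<in> R"
  by (induction n) (auto simp: subring_ofD)

lemma subring_of_sum: "subring_of R \<Longrightarrow> (\<And>i. i \<in> I \<Longrightarrow> f i \<in> R) \<Longrightarrow> sum f I \<in> R"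
  by (induction I rule: infinite_finite_induct) (auto simp: subring_ofD)

lemma polys_over_closed:
  assumes "subring_of R"
  shows "p \<in> polys_over R \<Longrightarrow> r \<in> polys_over R \<Longrightarrow> p - r \<in> polys_over R"
    and "p \<in> polys_over R \<Longrightarrow> r \<in> polys_over R \<Longrightarrow> p + r \<in> polys_over R"
    and "p \<in> polys_over R \<Longrightarrow> r \<in> polys_over R \<Longrightarrow> p * r \<in> polys_over R"
    and "c \<in> R \<Longrightarrow> p \<in> polys_over R \<Longrightarrow> smult c p \<in> polys_over R"
    and "c \<in> R \<Longrightarrow> monom c n \<in> polys_over R"
    and "p \<in> polys_over R \<Longrightarrow> reflect_poly p \<in> polys_over R"
    and "p \<in> polys_over R \<Longrightarrow> x \<in> R \<Longrightarrow> poly p x \<in> R"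
  using assms
  by (auto simp: polys_over_def coeff_mult coeff_reflect_poly poly_altdef
           intro!: subring_ofD subring_of_sum subring_of_power)

definition adjoin :: "'k::field set \<Rightarrow> 'k \<Rightarrow> 'k set" where
  "adjoin R z = (\<lambda>p. poly p z) ` polys_over R"

lemma subring_of_adjoin:
  assumes "subring_of R"
  shows "subring_of (adjoin R z)"
  unfolding subring_of_def
proof (intro conjI ballI)
  have "monom 1 0 \<in> polys_over R"
    by (intro polys_over_closed assms subring_ofD)
  then show "1 \<in> adjoin R z" by (force simp: adjoin_def)
next
  fix x y assume "x \<in> adjoin R z" "y \<in> adjoin R z"
  then obtain p r where "p \<in> polys_over R" "r \<in> polys_over R" "x = poly p z" "y = poly r z"
    by (auto simp: adjoin_def)
  then show "x - y \<in> adjoin R z" "x * y \<in> adjoin R z"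
    using polys_over_closed(1,3)[OF assms, of p r]
    by (auto simp: adjoin_def simp flip: poly_diff poly_mult)
qed

lemma subset_adjoin: "subring_of R \<Longrightarrow> R \<subseteq> adjoin R z"
  using polys_over_closed(5)[of R _ 0] by (force simp: adjoin_def poly_monom)

lemma in_adjoin:
  assumes "subring_of R"
  shows "z \<in> adjoin R z"
proof -
  have "monom 1 1 \<in> polys_over R"
    by (intro polys_over_closed assms subring_ofD)
  then show ?thesis by (force simp: adjoin_def poly_monom)
qed

text \<open>The key step of Chevalley's extension theorem. All elements \<open>1 - y * b\<close> are
  units, so the constant term can be removed from the relation in \<open>inverse z\<close>;
  multiplied by a power of \<open>z\<close>, this expresses the leading power of \<open>z\<close> in
  \<open>p\<close> through lower ones. The degrees drop until both polynomials are constant, and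
  then \<open>inverse y\<close> lies in \<open>R\<close>.\<close>

lemma no_relations_over_both:
  assumes R: "subring_of R" and y: "y \<in> R" "inverse y \<notin> R"
    and unit: "\<And>b. b \<in> R \<Longrightarrow> inverse (1 - y * b) \<in> R"
    and "p \<in> polys_over R" "r \<in> polys_over R"
    and "z \<noteq> 0" "y * poly p z = 1" "y * poly r (inverse z) = 1"
  shows False
  using assms(5-)
proof (induction "degree p + degree r" arbitrary: p r z rule: less_induct)
  \<comment> \<open>Cancel the leading term of the polynomial of larger degree with the help of the other one.\<close>
  have reduce: False
    if IH: "\<And>p'. p' \<in> polys_over R \<Longrightarrow> degree p' < degree p \<Longrightarrow> y * poly p' z = 1 \<Longrightarrow> False"
      and p: "p \<in> polys_over R" "y * poly p z = 1"
      and r: "r \<in> polys_over R" "y * poly r (inverse z) = 1"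
      and z: "z \<noteq> 0" and le: "degree r \<le> degree p" for p r z
  proof -
    define n a b where "n = degree p" and "a = coeff p n" and "b = coeff r 0"
    have ab: "a \<in> R" "b \<in> R" using p r by (auto simp: a_def b_def polys_over_def)
    show False
    proof (cases "n = 0")
      case True
      then obtain c where c: "p = [:c:]" using degree_eq_zeroE n_def by metis
      have "c \<in> R" using p(1) by (auto simp: c polys_over_def dest: spec[of _ 0])
      moreover have "inverse y = c" using p(2) c by (simp add: inverse_unique)
      ultimately show False using y by simp
    next
      case False
      define u where "u = inverse (1 - y * b)"
      have u: "u \<in> R" unfolding u_def by (rule unit) (rule ab)
      have "1 - y * b \<noteq> 0"
      proof
        assume "1 - y * b = 0"
        then have "inverse y = b" by (simp add: inverse_unique)
        then show False using y ab by simp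
      qed
      then have u1: "u * (1 - y * b) = 1" by (simp add: u_def)
      \<comment> \<open>\<open>poly Q z\<close> is \<open>z ^ n * poly r (inverse z)\<close>; the
        constant term \<open>b\<close> of \<open>r\<close> becomes the coefficient of degree
        \<open>n\<close>.\<close>
      define Q where "Q = monom 1 (n - degree r) * reflect_poly r"
      have Q: "Q \<in> polys_over R"
        unfolding Q_def by (intro polys_over_closed R subring_ofD r)
      have "y * poly Q z = z ^ (n - degree r) * z ^ degree r * (y * poly r (inverse z))"
        using z by (simp add: Q_def poly_monom poly_reflect_poly_nz)
      also have "\<dots> = z ^ n"
        using le r(2) by (simp add: n_def flip: power_add)
      finally have Qz: "y * poly Q z = z ^ n" .
      have "degree Q \<le> (n - degree r) + degree r"
        unfolding Q_def
        by (rule order_trans[OF degree_mult_le add_mono[OF degree_monom_le degree_reflect_poly_le]])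
      then have degQ: "degree Q \<le> n" using le n_def by simp
      have coeffQ: "coeff Q n = b"
        using le by (simp add: Q_def n_def b_def coeff_monom_mult coeff_reflect_poly)
      \<comment> \<open>From \<open>u * (1 - y * b) = 1\<close> follows
        \<open>z ^ n = y * u * (poly Q z - b * z ^ n)\<close>, whose right side involves only powers
        below \<open>n\<close>; \<open>p'\<close> makes this substitution in the leading term
        \<open>a * z ^ n\<close>.\<close>
      define p' where "p' = p - monom a n + smult (a * y * u) (Q - monom b n)"
      have "p' \<in> polys_over R"
        unfolding p'_def by (intro polys_over_closed R subring_ofD p(1) Q ab u y)
      moreover have "degree p' \<le> n"
        unfolding p'_def
        by (intro degree_add_le degree_diff_le order_trans[OF degree_smult_le] degree_monom_le degQ)
           (simp add: n_def)
      moreover have "coeff p' n = 0"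
        by (simp add: p'_def coeffQ a_def)
      ultimately have "p' \<in> polys_over R" "degree p' < degree p"
        using False eq_zero_or_degree_less[of p' n] by (auto simp: n_def)
      moreover have "y * poly p' z = 1"
      proof -
        have "y * poly p' z = y * poly p z - y * a * z ^ n
            + y * a * u * (y * poly Q z - y * b * z ^ n)"
          by (simp add: p'_def poly_monom algebra_simps)
        also have "\<dots> = 1 - y * a * z ^ n + y * a * z ^ n * (u * (1 - y * b))"
          by (simp add: p(2) Qz algebra_simps)
        finally show ?thesis by (simp add: u1)
      qed
      ultimately show False by (rule IH)
    qed
  qed
  case (less p r z)
  show False
  proof (cases "degree r \<le> degree p")
    case True
    show False
    proof (rule reduce[of p z r])
      fix p' assume "p' \<in> polys_over R" "degree p' < degree p" "y * poly p' z = 1"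
      then show False using less by (intro less.hyps[of p' r z]) auto
    qed (use less True in auto)
  next
    case False
    show False
    proof (rule reduce[of r "inverse z" p])
      fix r' assume "r' \<in> polys_over R" "degree r' < degree r" "y * poly r' (inverse z) = 1"
      then show False using less by (intro less.hyps[of p r' z]) auto
    qed (use less False in auto)
  qed
qed

text \<open>Zorn's lemma gives a ring \<open>R\<close> maximal among those that contain
  \<open>R0\<close> and omit \<open>inverse y\<close>. By maximality \<open>inverse y\<close> lies
  in \<open>R[z]\<close> for each \<open>z\<close> outside \<open>R\<close>; were \<open>z\<close>
  and \<open>inverse z\<close> both outside, the preceding lemma would be contradicted.\<close>

lemma exists_valuation_ring:
  assumes R0: "subring_of R0" and "y \<in> R0" "inverse y \<notin> R0"
  obtains R where "subring_of R" "R0 \<subseteq> R" "inverse y \<notin> R" "\<And>x. x \<in> R \<or> inverse x \<in> R"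
proof -
  define \<R> where "\<R> = {R. subring_of R \<and> R0 \<subseteq> R \<and> inverse y \<notin> R}"
  have "\<exists>R\<in>\<R>. \<forall>X\<in>\<R>. R \<subseteq> X \<longrightarrow> X = R"
  proof (rule subset_Zorn_nonempty)
    show "\<R> \<noteq> {}" using assms by (auto simp: \<R>_def)
  next
    fix \<C> assume ne: "\<C> \<noteq> {}" and chain: "subset.chain \<R> \<C>"
    have sub: "C \<in> \<C> \<Longrightarrow> C \<in> \<R>" for C using chain by (auto simp: subset.chain_def)
    have "subring_of (\<Union>\<C>)"
      unfolding subring_of_def
    proof (intro conjI ballI)
      show "1 \<in> \<Union>\<C>" using ne sub by (auto simp: \<R>_def subring_of_def)
    next
      fix a b assume "a \<in> \<Union>\<C>" "b \<in> \<Union>\<C>"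
      then obtain C where "C \<in> \<C>" "a \<in> C" "b \<in> C"
        using chain by (auto simp: subset.chain_def) blast
      then show "a - b \<in> \<Union>\<C>" "a * b \<in> \<Union>\<C>"
        using sub[of C] by (auto simp: \<R>_def subring_of_def)
    qed
    then show "\<Union>\<C> \<in> \<R>" using ne sub by (auto simp: \<R>_def)
  qed
  then obtain R where R: "R \<in> \<R>" and max: "\<And>X. X \<in> \<R> \<Longrightarrow> R \<subseteq> X \<Longrightarrow> X = R"
    by blast
  have ring: "subring_of R" and sub: "R0 \<subseteq> R" and y: "y \<in> R" "inverse y \<notin> R"
    using R assms by (auto simp: \<R>_def)
  have adjoin: "inverse y \<in> adjoin R z" if "z \<notin> R" for z
  proof (rule ccontr)
    assume "inverse y \<notin> adjoin R z"
    then have "adjoin R z \<in> \<R>"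
      using subring_of_adjoin[OF ring] subset_adjoin[OF ring] sub by (auto simp: \<R>_def)
    then have "adjoin R z = R" using max subset_adjoin[OF ring] by blast
    then show False using in_adjoin[OF ring] that by blast
  qed
  have y0: "y \<noteq> 0" using y by auto
  \<comment> \<open>If \<open>t = 1 - y * b\<close> had no inverse in \<open>R\<close>, then
    \<open>inverse y\<close> would be a polynomial in \<open>inverse t\<close>. Clearing
    denominators puts some \<open>t ^ m * inverse y\<close> in \<open>R\<close>, and since
    \<open>t ^ m\<close> is 1 modulo \<open>y\<close>, also \<open>inverse y\<close>.\<close>
  have unit: "inverse (1 - y * b) \<in> R" if b: "b \<in> R" for b
  proof (rule ccontr)
    define t where "t = 1 - y * b"
    have t: "t \<in> R" unfolding t_def by (intro subring_ofD ring y b)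
    assume "inverse (1 - y * b) \<notin> R"
    then obtain p where p: "p \<in> polys_over R" "inverse y = poly p (inverse t)"
      using adjoin unfolding t_def adjoin_def by blast
    have "t \<noteq> 0"
    proof
      assume "t = 0"
      then have "inverse y = b" by (simp add: t_def inverse_unique)
      then show False using y b by simp
    qed
    then have "t ^ degree p * inverse y = poly (reflect_poly p) t"
      by (simp add: p poly_reflect_poly_nz)
    then have in_R: "t ^ degree p * inverse y \<in> R"
      using polys_over_closed(6,7)[OF ring] p(1) t by simp
    have "\<exists>e\<in>R. t ^ m = 1 - y * e" for m
    proof (induction m)
      case 0
      show ?case by (rule bexI[of _ 0]) (auto simp: ring subring_ofD)
    next
      case (Suc m)
      then obtain e where e: "e \<in> R" "t ^ m = 1 - y * e" by blast
      have "t ^ Suc m = (1 - y * b) * (1 - y * e)"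
        by (simp add: e(2) flip: t_def)
      then have "t ^ Suc m = 1 - y * (e + b * (1 - y * e))"
        by (simp add: algebra_simps)
      then show ?case by (rule bexI) (intro subring_ofD ring e b y)
    qed
    then obtain e where e: "e \<in> R" "t ^ degree p = 1 - y * e" by blast
    have "inverse y = t ^ degree p * inverse y + e"
      using y0 by (simp add: e field_simps)
    also have "\<dots> \<in> R" by (intro subring_ofD ring in_R e)
    finally show False using y by simp
  qed
  have "z \<in> R \<or> inverse z \<in> R" for z
  proof (rule ccontr)
    assume "\<not> (z \<in> R \<or> inverse z \<in> R)"
    then have z: "z \<notin> R" "inverse z \<notin> R" by auto
    obtain p where p: "p \<in> polys_over R" "inverse y = poly p z"
      using adjoin[OF z(1)] by (auto simp: adjoin_def)
    obtain r where r: "r \<in> polys_over R" "inverse y = poly r (inverse z)"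
      using adjoin[OF z(2)] by (auto simp: adjoin_def)
    have "z \<noteq> 0" using z(1) subring_ofD(2)[OF ring] by auto
    then show False
      using no_relations_over_both[OF ring y unit p(1) r(1), of z] y0 by (simp flip: p(2) r(2))
  qed
  with ring sub y that show ?thesis by blast
qed

section \<open>Valuations and power sums\<close>

locale integer_valuation =
  fixes w :: "'k::field \<Rightarrow> int"
  assumes val_mult: "x \<noteq> 0 \<Longrightarrow> y \<noteq> 0 \<Longrightarrow> w (x * y) = w x + w y"
    and val_add: "x \<noteq> 0 \<Longrightarrow> y \<noteq> 0 \<Longrightarrow> x + y \<noteq> 0 \<Longrightarrow> min (w x) (w y) \<le> w (x + y)"
begin

text \<open>The fractional ideal of the elements of order at least \<open>m\<close>; 0 is added by
  hand because the value \<open>w 0\<close> carries no meaning.\<close>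

definition val_ball :: "int \<Rightarrow> 'k set" where
  "val_ball m = {x. x = 0 \<or> m \<le> w x}"

lemma val_one [simp]: "w 1 = 0"
  using val_mult[of 1 1] by simp

lemma val_minus [simp]: "w (- x) = w x"
proof (cases "x = 0")
  case False
  have "w (- 1) + w (- 1) = 0" using val_mult[of "- 1" "- 1"] by simp
  then show ?thesis using val_mult[of "- 1" x] False by simp
qed simp

lemma val_inverse: "x \<noteq> 0 \<Longrightarrow> w (inverse x) = - w x"
  using val_mult[of x "inverse x"] by simp

lemma val_divide: "x \<noteq> 0 \<Longrightarrow> y \<noteq> 0 \<Longrightarrow> w (x / y) = w x - w y"
  using val_mult[of x "inverse y"] by (simp add: val_inverse divide_inverse)

lemma val_power: "x \<noteq> 0 \<Longrightarrow> w (x ^ n) = int n * w x"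
  by (induction n) (auto simp: val_mult algebra_simps)

lemma val_power_int: "x \<noteq> 0 \<Longrightarrow> w (x powi k) = k * w x"
  by (cases "k \<ge> 0") (auto simp: power_int_def val_power val_inverse)

lemma zero_in_val_ball [simp]: "0 \<in> val_ball m"
  by (simp add: val_ball_def)

lemma one_in_val_ball [simp]: "1 \<in> val_ball 0"
  by (simp add: val_ball_def)

lemma val_ball_add: "x \<in> val_ball m \<Longrightarrow> y \<in> val_ball m \<Longrightarrow> x + y \<in> val_ball m"
  unfolding val_ball_def using val_add[of x y]
  by (cases "x = 0"; cases "y = 0"; cases "x + y = 0") auto

lemma val_ball_minus: "x \<in> val_ball m \<Longrightarrow> - x \<in> val_ball m"
  by (auto simp: val_ball_def)

lemma val_ball_diff: "x \<in> val_ball m \<Longrightarrow> y \<in> val_ball m \<Longrightarrow> x - y \<in> val_ball m"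
  using val_ball_add[of x m "- y"] val_ball_minus[of y m] by simp

lemma val_ball_mult: "x \<in> val_ball m \<Longrightarrow> y \<in> val_ball n \<Longrightarrow> x * y \<in> val_ball (m + n)"
  unfolding val_ball_def using val_mult[of x y] by (cases "x = 0"; cases "y = 0") auto

lemma val_ball_sum: "(\<And>i. i \<in> I \<Longrightarrow> f i \<in> val_ball m) \<Longrightarrow> sum f I \<in> val_ball m"
  by (induction I rule: infinite_finite_induct) (auto intro: val_ball_add)

lemma val_ball_prod: "(\<And>i. i \<in> I \<Longrightarrow> f i \<in> val_ball 0) \<Longrightarrow> prod f I \<in> val_ball 0"
  using val_ball_mult[of _ 0 _ 0]
  by (induction I rule: infinite_finite_induct) auto

text \<open>\<open>x - y\<close> divides \<open>x ^ n - y ^ n\<close> in the valuation ring. For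
  negative exponents this applies to the inverses, since \<open>inverse x - inverse y\<close> is
  \<open>x - y\<close> up to a unit factor.\<close>

lemma unit_power_int_diff_in_val_ball:
  assumes "x \<noteq> 0" "y \<noteq> 0" "w x = 0" "w y = 0" "x - y \<in> val_ball m"
  shows "x powi k - y powi k \<in> val_ball m"
proof -
  have power: "x ^ n - y ^ n \<in> val_ball m"
    if "x - y \<in> val_ball m" "x \<in> val_ball 0" "y \<in> val_ball 0" for x y n
  proof (induction n)
    case (Suc n)
    have "y ^ n \<in> val_ball 0"
      using val_ball_prod[of "{..<n}" "\<lambda>_. y"] that by simp
    then have "x * (x ^ n - y ^ n) + (x - y) * y ^ n \<in> val_ball m"
      using val_ball_add val_ball_mult[OF that(2) Suc] val_ball_mult[OF that(1)] by force
    then show ?case by (simp add: algebra_simps)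
  qed simp
  show ?thesis
  proof (cases "k \<ge> 0")
    case True
    then show ?thesis using power[of x y] assms by (simp add: power_int_def val_ball_def)
  next
    case False
    have "inverse x * inverse y \<in> val_ball 0"
      using assms by (simp add: val_ball_def val_mult val_inverse)
    then have "- (x - y) * (inverse x * inverse y) \<in> val_ball m"
      using val_ball_mult[OF val_ball_minus[OF assms(5)], of _ 0] by simp
    also have "- (x - y) * (inverse x * inverse y) = inverse x - inverse y"
      using assms by (simp add: field_simps)
    finally have "inverse x ^ nat (- k) - inverse y ^ nat (- k) \<in> val_ball m"
      using assms by (intro power) (auto simp: val_ball_def val_inverse)
    then show ?thesis using False by (simp add: power_int_def)
  qed
qed

end

lemma integer_valuation_if_normalized: "normalized_valuation R w \<Longrightarrow> integer_valuation w"
  unfolding normalized_valuation_def integer_valuation_def by blast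

text \<open>The pairs \<open>{x, h x}\<close> partition \<open>X\<close>. The target
  \<open>E\<close> is left general: it is \<open>{0}\<close> when the parity of
  \<open>card F\<close> is determined, and a ball in the estimate of the power sums.\<close>

lemma sum_involution_closed:
  assumes "finite X"
    and zero: "0 \<in> E" and add: "\<And>x y. x \<in> E \<Longrightarrow> y \<in> E \<Longrightarrow> x + y \<in> E"
    and "\<And>x. x \<in> X \<Longrightarrow> h x \<in> X" "\<And>x. x \<in> X \<Longrightarrow> h (h x) = x" "\<And>x. x \<in> X \<Longrightarrow> h x \<noteq> x"
    and "\<And>x. x \<in> X \<Longrightarrow> f x + f (h x) \<in> E"
  shows "sum f X \<in> E"
  using assms(1,4-)
proof (induction X rule: finite_psubset_induct)
  case (psubset X)
  show ?case
  proof (cases "X = {}")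
    case False
    then obtain x where x: "x \<in> X" by blast
    have "sum f (X - {x, h x}) \<in> E"
    proof (rule psubset.IH)
      fix y assume y: "y \<in> X - {x, h x}"
      show "h y \<in> X - {x, h x}"
      proof -
        have "h y \<noteq> x" "h y \<noteq> h x" using y psubset.prems(2)[of y] psubset.prems(2)[OF x] by auto
        then show ?thesis using psubset.prems(1) y by auto
      qed
    qed (use x psubset.prems in auto)
    moreover have "sum f X = sum f (X - {x, h x}) + (f x + f (h x))"
      using sum.subset_diff[of "{x, h x}" X f] x psubset.prems(1,3)[OF x] psubset.hyps by auto
    ultimately show ?thesis using add psubset.prems(4)[OF x] by simp
  qed (simp add: zero)
qed

text \<open>Multiplication by \<open>c\<close> permutes the non-zero elements of \<open>F\<close>,
  so it preserves their product, which is non-zero and can be cancelled.\<close>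

lemma subfield_power_card_minus_1:
  assumes F: "is_subfield F" "finite F" and c: "c \<in> F" "c \<noteq> 0"
  shows "c ^ (card F - 1) = 1"
proof -
  have mult: "x * y \<in> F" "inverse x \<in> F" if "x \<in> F" "y \<in> F" for x y
    using F that by (auto simp: is_subfield_def)
  have "bij_betw ((*) c) (F - {0}) (F - {0})"
  proof (rule bij_betw_byWitness[of _ "(*) (inverse c)"])
    show "(*) c ` (F - {0}) \<subseteq> F - {0}" "(*) (inverse c) ` (F - {0}) \<subseteq> F - {0}"
      using c mult by auto
  qed (use c in \<open>auto simp: field_simps\<close>)
  then have "(\<Prod>x\<in>F - {0}. x) = (\<Prod>x\<in>F - {0}. c * x)"
    by (rule prod.reindex_bij_betw[symmetric])
  also have "\<dots> = c ^ card (F - {0}) * (\<Prod>x\<in>F - {0}. x)"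
    by (simp add: prod.distrib)
  finally have "c ^ card (F - {0}) = 1" using F(2) by simp
  then show ?thesis using F by (simp add: card_Diff_singleton is_subfield_def)
qed

lemma sum_square_char_2:
  fixes f :: "'b \<Rightarrow> 'a::comm_ring_1"
  assumes "\<And>x::'a. x + x = 0"
  shows "(\<Sum>i\<in>I. f i) * (\<Sum>i\<in>I. f i) = (\<Sum>i\<in>I. f i * f i)"
proof (induction I rule: infinite_finite_induct)
  case (insert i I)
  have "(f i + sum f I) * (f i + sum f I) =
      f i * f i + sum f I * sum f I + (f i * sum f I + f i * sum f I)"
    by (simp add: algebra_simps)
  then show ?case using insert by (simp add: assms)
qed auto

section \<open>Regular elements, with the valuations \<open>w\<close> at infinity and
  \<open>u\<close> at \<open>v\<close>\<close>

locale coprime_power_sums =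
  fixes F :: "'k::field set" and R :: "'k set" and w :: "'k \<Rightarrow> int"
    and \<iota> :: "'k \<Rightarrow> 'm::field" and sg :: "'m \<Rightarrow> 'k" and v :: 'k and u :: "'k \<Rightarrow> int"
  assumes subfield: "is_subfield F" and finite_F: "finite F" and char_2: "\<And>x::'k. x + x = 0"
    and rational: "rational_place F R" and w: "normalized_valuation R w"
    and \<iota>_one: "\<iota> 1 = 1" and \<iota>_mult: "\<And>x y. \<iota> (x * y) = \<iota> x * \<iota> y"
    and sign: "sign_function F \<iota> sg"
    and prime: "prime_in (regular_outside F R) v"
    and u: "normalized_valuation (localization_at (regular_outside F R) v) u"
begin

abbreviation A :: "'k set" where "A \<equiv> regular_outside F R"

sublocale w: integer_valuation w by (rule integer_valuation_if_normalized[OF w])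
sublocale u: integer_valuation u by (rule integer_valuation_if_normalized[OF u])

lemma F_subring: "subring_of F"
  using subfield by (auto simp: is_subfield_def subring_of_def)

lemma in_R_iff: "x \<in> R \<longleftrightarrow> x = 0 \<or> 0 \<le> w x"
  using w by (auto simp: normalized_valuation_def)

lemma F_subset_R: "F \<subseteq> R"
  using rational by (auto simp: rational_place_def place_def)

lemma val_constant:
  assumes "c \<in> F" "c \<noteq> 0"
  shows "w c = 0"
proof -
  have "inverse c \<in> F" using subfield assms by (auto simp: is_subfield_def)
  then have "c \<in> R" "inverse c \<in> R" using F_subset_R assms by auto
  then show ?thesis using assms by (auto simp: in_R_iff w.val_inverse)
qed

lemma place_subring: "place F R' \<Longrightarrow> subring_of R'"
  using subring_ofD(1)[OF F_subring] by (auto simp: place_def subring_of_def)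

lemma A_subring: "subring_of A"
  using place_subring by (auto simp: regular_outside_def subring_of_def)

lemma F_subset_A: "F \<subseteq> A"
  by (auto simp: regular_outside_def place_def)

text \<open>By Horner's rule: \<open>y * poly p y\<close> has a pole at infinity and the constant
  \<open>c\<close> has none, so their sum is neither 0 nor vanishes at infinity. Hence no non-zero
  element of \<open>F[y]\<close> vanishes there.\<close>

lemma poly_over_F_nonzero:
  assumes "y \<noteq> 0" "w y < 0" "p \<in> polys_over F" "p \<noteq> 0"
  shows "poly p y \<noteq> 0 \<and> w (poly p y) \<le> 0"
  using assms(3,4)
proof (induction p)
  case (pCons c p)
  have c: "c \<in> F" and p: "p \<in> polys_over F"
    using pCons.prems(1) by (auto simp: polys_over_def dest: spec[of _ 0] spec[of _ "Suc _"])
  show ?case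
  proof (cases "p = 0")
    case True
    then show ?thesis using pCons.hyps c val_constant by auto
  next
    case False
    define z where "z = y * poly p y"
    have z: "z \<noteq> 0" "w z < 0"
      using pCons.IH[OF p False] assms by (auto simp: z_def w.val_mult)
    have "\<not> (c + z = 0 \<or> 0 < w (c + z))"
    proof
      assume "c + z = 0 \<or> 0 < w (c + z)"
      then have "c + z \<in> w.val_ball 0" by (auto simp: w.val_ball_def)
      moreover have "c \<in> w.val_ball 0" using c val_constant by (cases "c = 0") (auto simp: w.val_ball_def)
      ultimately have "(c + z) - c \<in> w.val_ball 0" by (rule w.val_ball_diff)
      then show False using z by (simp add: w.val_ball_def)
    qed
    then show ?thesis by (simp add: z_def)
  qed
qed simp

text \<open>
  If \<open>a\<close> vanishes at infinity, then \<open>a\<close> is not in \<open>F[1/a]\<close>, so some valuation ring contains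
  \<open>F[1/a]\<close> but not \<open>a\<close>. This is a place other than infinity at which \<open>a\<close> has a pole.
\<close>

lemma val_regular_le_0:
  assumes "a \<in> A" "a \<noteq> 0"
  shows "w a \<le> 0"
proof (rule ccontr)
  assume "\<not> w a \<le> 0"
  then have pos: "w a > 0" by simp
  define y where "y = inverse a"
  have y: "y \<noteq> 0" "inverse y = a" "w y < 0"
    using assms pos by (auto simp: y_def w.val_inverse)
  have "inverse y \<notin> adjoin F y"
  proof
    assume "inverse y \<in> adjoin F y"
    then obtain p where p: "p \<in> polys_over F" "a = poly p y" by (auto simp: adjoin_def y)
    then have "p \<noteq> 0" using assms by auto
    from poly_over_F_nonzero[OF y(1,3) p(1) this] pos show False by (simp add: p(2))
  qed
  then obtain R' where R': "subring_of R'" "adjoin F y \<subseteq> R'" "inverse y \<notin> R'"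
      "\<And>x. x \<in> R' \<or> inverse x \<in> R'"
    using exists_valuation_ring[OF subring_of_adjoin[OF F_subring] in_adjoin[OF F_subring]] by metis
  have "F \<subseteq> R'" "y \<in> R'" using R'(2) subset_adjoin[OF F_subring] in_adjoin[OF F_subring] by auto
  \<comment> \<open>The pole of \<open>y\<close> at infinity shows that \<open>R'\<close> contains
    \<open>F\<close> properly and differs from \<open>R\<close>.\<close>
  moreover have "y \<notin> F" "y \<notin> R" using y F_subset_R by (auto simp: in_R_iff)
  ultimately have "place F R'" "R' \<noteq> R"
    using R' by (auto simp: place_def subring_of_def)
  then have "A \<subseteq> R'" by (auto simp: regular_outside_def)
  then show False using assms R'(3) y(2) by auto
qed

text \<open>These are the Riemann-Roch spaces of the multiples of infinity. A regular element
  without pole at infinity differs from its residue by a regular element that vanishes there, so it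
  is constant. When one more pole order is allowed, the new elements are \<open>c * b + g\<close>
  with a fixed \<open>b\<close> of the new order and \<open>c\<close> the residue of
  \<open>a / b\<close>, which can be taken in \<open>F\<close>.\<close>

lemma finite_regular_bounded: "finite {a \<in> A. a = 0 \<or> - int D \<le> w a}"
proof (induction D)
  case 0
  have "{a \<in> A. a = 0 \<or> - int 0 \<le> w a} \<subseteq> F"
  proof
    fix a assume a: "a \<in> {a \<in> A. a = 0 \<or> - int 0 \<le> w a}"
    then have "a \<in> R" by (auto simp: in_R_iff)
    then obtain c where c: "c \<in> F" "a - c \<in> maximal_ideal_of R"
      using rational by (auto simp: rational_place_def)
    have "a - c \<in> A" using a c F_subset_A subring_ofD(4)[OF A_subring] by auto
    moreover have "a - c = 0 \<or> w (a - c) > 0"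
      using c(2) by (auto simp: maximal_ideal_of_def in_R_iff w.val_inverse)
    ultimately have "a - c = 0" using val_regular_le_0[of "a - c"] by force
    then show "a \<in> F" using c by simp
  qed
  then show ?case using finite_F finite_subset by blast
next
  case (Suc D)
  let ?G = "\<lambda>D. {a \<in> A. a = 0 \<or> - int D \<le> w a}"
  show ?case
  proof (cases "\<exists>b\<in>A. b \<noteq> 0 \<and> w b = - int (Suc D)")
    case False
    then have "?G (Suc D) = ?G D" by force
    then show ?thesis using Suc by simp
  next
    case True
    then obtain b where b: "b \<in> A" "b \<noteq> 0" "w b = - int (Suc D)" by blast
    have "?G (Suc D) \<subseteq> (\<lambda>(c, g). c * b + g) ` (F \<times> ?G D)"
    proof
      fix a assume a: "a \<in> ?G (Suc D)"
      show "a \<in> (\<lambda>(c, g). c * b + g) ` (F \<times> ?G D)"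
      proof (cases "a = 0 \<or> - int D \<le> w a")
        case True
        then have "(0, a) \<in> F \<times> ?G D" using a subring_ofD(2)[OF F_subring] by auto
        then show ?thesis by force
      next
        case False
        then have a0: "a \<noteq> 0" "w a = - int (Suc D)" using a by auto
        then have "a / b \<in> R" using b by (simp add: in_R_iff w.val_divide)
        then obtain c where c: "c \<in> F" "a / b - c \<in> maximal_ideal_of R"
          using rational by (auto simp: rational_place_def)
        have ab: "a - c * b = b * (a / b - c)" using b by (simp add: field_simps)
        have "a / b - c = 0 \<or> w (a / b - c) > 0"
          using c(2) by (auto simp: maximal_ideal_of_def in_R_iff w.val_inverse)
        then have "a - c * b = 0 \<or> - int D \<le> w (a - c * b)"
          using b unfolding ab by (cases "a / b - c = 0") (auto simp: w.val_mult)
        moreover have "a - c * b \<in> A"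
          using a b c F_subset_A by (intro subring_ofD A_subring) auto
        ultimately have "(c, a - c * b) \<in> F \<times> ?G D" using c by auto
        then show ?thesis by (force intro: rev_image_eqI)
      qed
    qed
    then show ?thesis
      using finite_subset finite_cartesian_product[OF finite_F Suc] by blast
  qed
qed

lemma not_dvd_if_coprime:
  assumes "coprime_in A a v"
  shows "\<not> dvd_in A v a"
proof
  assume "dvd_in A v a"
  then obtain z where z: "z \<in> A" "a = v * z" by (auto simp: dvd_in_def)
  obtain x y where xy: "x \<in> A" "y \<in> A" "x * a + y * v = 1"
    using assms by (auto simp: coprime_in_def)
  have "1 = v * (x * z + y)" using xy(3) z(2) by (simp add: algebra_simps)
  moreover have "x * z + y \<in> A" using xy z by (intro subring_ofD A_subring)
  ultimately show False using prime by (auto simp: prime_in_def dvd_in_def)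
qed

lemma in_localization_iff: "x \<in> localization_at A v \<longleftrightarrow> x = 0 \<or> 0 \<le> u x"
  using u by (auto simp: normalized_valuation_def)

lemma localizationI: "a \<in> A \<Longrightarrow> b \<in> A \<Longrightarrow> \<not> dvd_in A v b \<Longrightarrow> a / b \<in> localization_at A v"
  by (auto simp: localization_at_def)

lemma v_in_A: "v \<in> A" and v_nonzero: "v \<noteq> 0" and v_not_unit: "\<not> dvd_in A v 1"
  using prime by (auto simp: prime_in_def)

text \<open>Otherwise \<open>1 / v\<close> would be a fraction \<open>a / b\<close> of the
  localization, and \<open>b = v * a\<close> would be divisible by \<open>v\<close>.\<close>

lemma val_prime_pos: "0 < u v"
proof (rule ccontr)
  assume "\<not> 0 < u v"
  then have "1 / v \<in> localization_at A v"
    by (simp add: in_localization_iff u.val_divide v_nonzero)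
  then obtain a b where ab: "a \<in> A" "b \<in> A" "\<not> dvd_in A v b" "1 / v = a / b"
    by (auto simp: localization_at_def)
  show False
  proof (cases "b = 0")
    case True
    then show False using ab v_nonzero by simp
  next
    case False
    then have "b = v * a" using ab(4) v_nonzero by (simp add: field_simps)
    then show False using ab by (auto simp: dvd_in_def)
  qed
qed

lemma coprime_nonzero: "coprime_in A a v \<Longrightarrow> a \<noteq> 0"
  using not_dvd_if_coprime[of a] subring_ofD(2)[OF A_subring] by (force simp: dvd_in_def)

lemma val_coprime:
  assumes "a \<in> A" "coprime_in A a v"
  shows "u a = 0"
proof -
  have nz: "a \<noteq> 0" by (rule coprime_nonzero) fact
  have "1 / a \<in> localization_at A v" "a / 1 \<in> localization_at A v"
    by (intro localizationI assms v_not_unit not_dvd_if_coprime subring_ofD(1)[OF A_subring])+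
  then show ?thesis using nz by (simp add: in_localization_iff u.val_divide)
qed

lemma coprime_add_power:
  assumes "coprime_in A a v" "m > 0"
  shows "coprime_in A (a + v ^ m) v"
proof -
  obtain x y where xy: "x \<in> A" "y \<in> A" "x * a + y * v = 1"
    using assms by (auto simp: coprime_in_def)
  obtain m' where m: "m = Suc m'" using assms(2) gr0_conv_Suc by blast
  have "x * (a + v ^ m) + (y - x * v ^ m') * v = 1"
    using xy(3) by (simp add: m algebra_simps)
  moreover have "y - x * v ^ m' \<in> A"
    using xy v_in_A by (intro subring_ofD A_subring subring_of_power)
  ultimately show ?thesis using xy by (auto simp: coprime_in_def)
qed

section \<open>Power sums over monic elements prime to \<open>v\<close>\<close>

abbreviation S :: "nat \<Rightarrow> int \<Rightarrow> 'k" where "S \<equiv> S_tilde A w \<iota> sg v"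

abbreviation coprime_monics :: "nat \<Rightarrow> 'k set" where
  "coprime_monics d \<equiv> {a \<in> monics_of_degree A w \<iota> sg d. coprime_in A a v}"

text \<open>Squaring is additive and turns \<open>a powi - s\<close> into
  \<open>a powi - (2 * s)\<close>. This becomes the hypothesis \<open>sq\<close> of the
  combinatorial relation, with doubling as \<open>g\<close>.\<close>

lemma S_double: "S d (2 * s) = S d s * S d s"
  unfolding S_tilde_def sum_square_char_2[OF char_2]
proof (rule sum.cong[OF refl])
  fix a assume "a \<in> coprime_monics d"
  then have "a \<noteq> 0" using coprime_nonzero by blast
  then show "a powi - (2 * s) = a powi - s * a powi - s"
    by (simp flip: power_int_add)
qed

lemma S_integral: "S d s \<in> u.val_ball 0"
  unfolding S_tilde_def
proof (rule u.val_ball_sum)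
  fix a assume "a \<in> coprime_monics d"
  then have "u a = 0" "a \<noteq> 0"
    using val_coprime coprime_nonzero by (auto simp: monics_of_degree_def)
  then show "a powi - s \<in> u.val_ball 0" by (simp add: u.val_ball_def u.val_power_int)
qed

text \<open>\<open>x \<mapsto> x + 1\<close> pairs off the elements of \<open>F\<close>.\<close>

lemma of_nat_card_F: "of_nat (card F) = (0 :: 'k)"
proof -
  have "(\<Sum>x\<in>F. 1 :: 'k) \<in> {0}"
  proof (rule sum_involution_closed[of _ _ "\<lambda>x. x + 1"])
    fix x assume x: "x \<in> F"
    show "x + 1 \<in> F" by (intro subring_ofD F_subring x)
    show "x + 1 + 1 = x" by (simp add: char_2 add.assoc)
  qed (auto simp: finite_F char_2)
  then show ?thesis by simp
qed

text \<open>Each \<open>a\<close> is uniquely a constant \<open>c = sg (\<iota> a)\<close> times a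
  monic element, and \<open>c powi - s = 1\<close> by the divisibility of \<open>s\<close>. So every
  monic element is counted \<open>card F - 1\<close> times, and this number is 1 in characteristic
  2.\<close>

lemma sum_coprime_of_degree:
  assumes "(int (card F) - 1) dvd s"
  shows "(\<Sum>a\<in>{a \<in> A. coprime_in A a v \<and> w a = - int d}. a powi - s) = S d s"
proof -
  let ?H = "{a \<in> A. coprime_in A a v \<and> w a = - int d}"
  have \<iota>_nonzero: "\<iota> x \<noteq> 0" if "x \<noteq> 0" for x
    using \<iota>_mult[of x "inverse x"] that \<iota>_one by auto
  have sg_mult: "sg (\<iota> (x * y)) = sg (\<iota> x) * sg (\<iota> y)" if "x \<noteq> 0" "y \<noteq> 0" for x y
    using sign that \<iota>_nonzero by (auto simp: sign_function_def \<iota>_mult)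
  have sg_F: "sg (\<iota> c) = c" if "c \<in> F - {0}" for c
    using sign that by (auto simp: sign_function_def)
  have sg_in_F: "sg (\<iota> x) \<in> F - {0}" if "x \<noteq> 0" for x
    using sign that \<iota>_nonzero by (auto simp: sign_function_def)
  have inv_F: "inverse c \<in> F - {0}" if "c \<in> F - {0}" for c
    using that subfield by (auto simp: is_subfield_def)
  have scale: "c * a \<in> A \<and> coprime_in A (c * a) v \<and> w (c * a) = w a"
    if "c \<in> F - {0}" "a \<in> A" "coprime_in A a v" for c a
  proof -
    obtain x y where xy: "x \<in> A" "y \<in> A" "x * a + y * v = 1"
      using \<open>coprime_in A a v\<close> by (auto simp: coprime_in_def)
    have "x * inverse c * (c * a) = x * a" using that(1) by (simp add: field_simps)
    then have "x * inverse c * (c * a) + y * v = 1" using xy(3) by (simp only:)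
    moreover have "x * inverse c \<in> A"
      using xy inv_F[OF that(1)] F_subset_A by (intro subring_ofD A_subring) auto
    ultimately have "coprime_in A (c * a) v" using xy by (auto simp: coprime_in_def)
    moreover have "c * a \<in> A" using that F_subset_A by (intro subring_ofD A_subring) auto
    ultimately show ?thesis
      using that coprime_nonzero[of a] by (simp add: w.val_mult val_constant)
  qed
  have power_1: "c powi - s = 1" if "c \<in> F - {0}" for c
  proof -
    obtain k where k: "s = (int (card F) - 1) * k" using assms by blast
    \<comment> \<open>Since \<open>F\<close> is non-empty, the integer
      \<open>int (card F) - 1\<close> agrees with the truncated difference \<open>card F - 1\<close>
      of natural numbers.\<close>
    have "card F > 0" using finite_F subring_ofD(1)[OF F_subring] card_gt_0_iff by blast
    then have "- s = int (card F - 1) * - k" by (simp add: k)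
    then have "c powi - s = (c powi int (card F - 1)) powi - k"
      by (simp only: power_int_mult)
    then show ?thesis
      using subfield_power_card_minus_1[OF subfield finite_F] that by simp
  qed
  have "(\<Sum>a\<in>?H. a powi - s) = (\<Sum>(c, a)\<in>(F - {0}) \<times> coprime_monics d. a powi - s)"
  proof (rule sum.reindex_bij_witness[of _ "\<lambda>(c, a). c * a"
      "\<lambda>a. (sg (\<iota> a), inverse (sg (\<iota> a)) * a)"], goal_cases)
    case (1 a)
    then show ?case using sg_in_F[of a] coprime_nonzero[of a] by auto
  next
    case (2 a)
    then have nz: "a \<noteq> 0" using coprime_nonzero by blast
    let ?c = "sg (\<iota> a)"
    have c: "?c \<in> F - {0}" by (rule sg_in_F[OF nz])
    have "sg (\<iota> (inverse ?c * a)) = inverse ?c * ?c"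
      using c nz sg_F[OF inv_F[OF c]] by (subst sg_mult) auto
    then have "monic_elt \<iota> sg (inverse ?c * a)"
      using c nz by (simp add: monic_elt_def)
    then show ?case using c scale[OF inv_F[OF c], of a] 2 by (auto simp: monics_of_degree_def)
  next
    case (3 b)
    then show ?case
      using sg_mult sg_F by (auto simp: monics_of_degree_def monic_elt_def)
  next
    case (4 b)
    then show ?case using scale by (auto simp: monics_of_degree_def)
  next
    case (5 a)
    then have nz: "a \<noteq> 0" using coprime_nonzero by blast
    show ?case
      using power_1[OF inv_F[OF sg_in_F[OF nz]]] by (simp add: power_int_mult_distrib)
  qed
  also have "\<dots> = of_nat (card (F - {0})) * S d s"
    by (simp add: S_tilde_def sum.cartesian_product[symmetric])
  also have "of_nat (card (F - {0})) = (1 :: 'k)"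
  proof -
    have "of_nat (card (F - {0})) + 1 = (0 :: 'k)"
      using finite_F subring_ofD(2)[OF F_subring] of_nat_card_F
      by (metis card_Suc_Diff1 of_nat_Suc add.commute)
    then show ?thesis using char_2[of 1] by (metis add_right_cancel)
  qed
  finally show ?thesis by simp
qed

text \<open>Non-zero regular elements have degree at least 0, so the natural numbers
  \<open>d < D\<close> sort all those of degree below \<open>D\<close>, and each degree contributes
  a finite set.\<close>

lemma sum_S:
  assumes "(int (card F) - 1) dvd s"
  shows "(\<Sum>d<D. S d s) = (\<Sum>a\<in>{a \<in> A. coprime_in A a v \<and> - int D < w a}. a powi - s)"
proof -
  let ?H = "\<lambda>d. {a \<in> A. coprime_in A a v \<and> w a = - int d}"
  have "finite (?H d)" for d
    by (rule finite_subset[OF _ finite_regular_bounded[of d]]) auto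
  then have "(\<Sum>a\<in>(\<Union>d<D. ?H d). a powi - s) = (\<Sum>d<D. \<Sum>a\<in>?H d. a powi - s)"
    by (intro sum.UNION_disjoint) auto
  moreover have "(\<Union>d<D. ?H d) = {a \<in> A. coprime_in A a v \<and> - int D < w a}" (is "_ = ?G")
  proof (intro equalityI subsetI)
    fix a assume a: "a \<in> ?G"
    then have "w a \<le> 0" using val_regular_le_0 coprime_nonzero by blast
    then have "a \<in> ?H (nat (- w a))" "nat (- w a) < D" using a by auto
    then show "a \<in> (\<Union>d<D. ?H d)" by blast
  qed auto
  ultimately show ?thesis by (simp add: sum_coprime_of_degree[OF assms])
qed

lemma sum_S_small:
  assumes "(int (card F) - 1) dvd s"
  shows "\<exists>D0. \<forall>D\<ge>D0. (\<Sum>d<D. S d s) \<in> u.val_ball (int m)"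
proof (intro exI allI impI)
  \<comment> \<open>The exponent \<open>Suc m\<close> is positive also for \<open>m = 0\<close>, as
    \<open>coprime_add_power\<close> requires; with \<open>u v \<ge> 1\<close> it gives
    \<open>u h \<ge> m\<close>.\<close>
  define h where "h = v ^ Suc m"
  have h: "h \<in> A" "h \<noteq> 0"
    unfolding h_def using v_in_A v_nonzero by (auto intro: subring_of_power[OF A_subring] simp del: power_Suc)
  have "int m * 1 \<le> int (Suc m) * u v" using val_prime_pos by (intro mult_mono) auto
  then have h_small: "h \<in> u.val_ball (int m)"
    unfolding h_def u.val_ball_def by (simp add: u.val_power v_nonzero del: power_Suc)
  \<comment> \<open>This bound makes \<open>D\<close> larger than the degree of \<open>h\<close>, so
    that adding \<open>h\<close> keeps degrees below \<open>D\<close>.\<close>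
  fix D assume D: "nat (- w h) + 1 \<le> D"
  let ?G = "{a \<in> A. coprime_in A a v \<and> - int D < w a}"
  have "(\<Sum>a\<in>?G. a powi - s) \<in> u.val_ball (int m)"
  proof (rule sum_involution_closed[of _ _ "\<lambda>a. a + h"])
    show "finite ?G"
      by (rule finite_subset[OF _ finite_regular_bounded[of D]]) auto
  next
    fix a assume a: "a \<in> ?G"
    have a': "a + h \<in> A" "coprime_in A (a + h) v"
      using a h(1) coprime_add_power[of a "Suc m"] by (auto simp: subring_ofD[OF A_subring] h_def)
    have nz: "a \<noteq> 0" "a + h \<noteq> 0" using a a' coprime_nonzero by auto
    have "- int D < min (w a) (w h)" using a D by auto
    also have "\<dots> \<le> w (a + h)" by (rule w.val_add) (use nz h in auto)
    finally show "a + h \<in> ?G" using a' by auto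
    have "a - (a + h) \<in> u.val_ball (int m)" using u.val_ball_minus[OF h_small] by simp
    then have "a powi - s - (a + h) powi - s \<in> u.val_ball (int m)"
      using a a' nz val_coprime by (intro u.unit_power_int_diff_in_val_ball) auto
    moreover have "x - y = x + y" for x y :: 'k
      using char_2[of y] by (metis add.assoc add_diff_cancel_right' add_0_right)
    ultimately show "a powi - s + (a + h) powi - s \<in> u.val_ball (int m)" by simp
    show "a + h + h = a" by (simp add: char_2 add.assoc)
  qed (use h in \<open>auto intro: u.val_ball_add\<close>)
  then show "(\<Sum>d<D. S d s) \<in> u.val_ball (int m)" by (simp add: sum_S[OF assms])
qed

end

section \<open>Symmetric sums of truncated multizeta values\<close>

definition decreasing_lists :: "nat \<Rightarrow> nat \<Rightarrow> nat list set" where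
  "decreasing_lists r D = {d. length d = r \<and> sorted_wrt (>) d \<and> set d \<subseteq> {..<D}}"

text \<open>Values lie in any commutative ring and exponents in any type: the relation below is
  combinatorial, and its arithmetic input is just the characteristic and the effect of
  squaring.\<close>

definition truncated_multizeta :: "(nat \<Rightarrow> 'b \<Rightarrow> 'a) \<Rightarrow> nat \<Rightarrow> 'b list \<Rightarrow> 'a::comm_ring_1" where
  "truncated_multizeta S D t = (\<Sum>d\<in>decreasing_lists (length t) D. \<Prod>j<length t. S (d ! j) (t ! j))"

text \<open>Summing over reorderings frees the exponents from the order of the degrees: the result
  runs over all placements of the elements of \<open>M\<close> at distinct degrees below
  \<open>D\<close>, equal elements being indistinguishable. It is an analogue of a monomial
  symmetric function.\<close>

definition symmetric_multizeta :: "(nat \<Rightarrow> 'b \<Rightarrow> 'a) \<Rightarrow> nat \<Rightarrow> 'b multiset \<Rightarrow> 'a::comm_ring_1" where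
  "symmetric_multizeta S D M = (\<Sum>t\<in>permutations_of_multiset M. truncated_multizeta S D t)"

lemma finite_decreasing_lists [simp]: "finite (decreasing_lists r D)"
  by (rule finite_subset[OF _ finite_lists_length_eq[of "{..<D}" r]])
     (auto simp: decreasing_lists_def)

lemma decreasing_lists_0 [simp]: "decreasing_lists 0 D = {[]}"
  by (auto simp: decreasing_lists_def)

lemma decreasing_lists_Suc_0 [simp]: "decreasing_lists (Suc r) 0 = {}"
  by (auto simp: decreasing_lists_def)

text \<open>The head is the largest entry: either it is \<open>D\<close>, or all entries lie below
  \<open>D\<close>.\<close>

lemma decreasing_lists_Suc_Suc:
  "decreasing_lists (Suc r) (Suc D) =
     decreasing_lists (Suc r) D \<union> (#) D ` decreasing_lists r D" (is "?L = ?R")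
proof
  show "?L \<subseteq> ?R"
  proof
    fix d assume "d \<in> ?L"
    then obtain a e where d: "d = a # e" "length e = r" "\<forall>x\<in>set e. x < a" "sorted_wrt (>) e" "a \<le> D"
      by (cases d) (auto simp: decreasing_lists_def)
    show "d \<in> ?R"
      by (cases "a = D") (use d in \<open>force simp: decreasing_lists_def\<close>)+
  qed
  show "?R \<subseteq> ?L"
    by (auto simp: decreasing_lists_def less_Suc_eq)
qed

lemma truncated_multizeta_Nil [simp]: "truncated_multizeta S D [] = 1"
  by (simp add: truncated_multizeta_def)

lemma truncated_multizeta_0_Cons [simp]: "truncated_multizeta S 0 (x # t) = 0"
  by (simp add: truncated_multizeta_def)

lemma truncated_multizeta_Suc_Cons:
  "truncated_multizeta S (Suc D) (x # t) =
     truncated_multizeta S D (x # t) + S D x * truncated_multizeta S D t"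
proof -
  have disj: "decreasing_lists (Suc (length t)) D \<inter> (#) D ` decreasing_lists (length t) D = {}"
    by (auto simp: decreasing_lists_def)
  have "truncated_multizeta S (Suc D) (x # t) = truncated_multizeta S D (x # t) +
      (\<Sum>d\<in>(#) D ` decreasing_lists (length t) D. \<Prod>j<Suc (length t). S (d ! j) ((x # t) ! j))"
    by (simp add: truncated_multizeta_def decreasing_lists_Suc_Suc sum.union_disjoint disj
          del: prod.lessThan_Suc)
  also have "(\<Sum>d\<in>(#) D ` decreasing_lists (length t) D. \<Prod>j<Suc (length t). S (d ! j) ((x # t) ! j))
      = S D x * truncated_multizeta S D t"
    unfolding truncated_multizeta_def
    by (subst sum.reindex)
       (auto simp: sum_distrib_left prod.lessThan_Suc_shift simp del: prod.lessThan_Suc)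
  finally show ?thesis .
qed

lemma symmetric_multizeta_0: "M \<noteq> {#} \<Longrightarrow> symmetric_multizeta S 0 M = 0"
  unfolding symmetric_multizeta_def
proof (rule sum.neutral, rule ballI)
  fix t assume "M \<noteq> {#}" "t \<in> permutations_of_multiset M"
  then show "truncated_multizeta S 0 t = 0"
    by (cases t) (auto simp: permutations_of_multiset_def)
qed

lemma sum_permutations_of_multiset:
  assumes "M \<noteq> {#}"
  shows "sum f (permutations_of_multiset M) =
           (\<Sum>x\<in>set_mset M. \<Sum>t\<in>permutations_of_multiset (M - {#x#}). f (x # t))"
proof -
  have "sum f (permutations_of_multiset M) =
      (\<Sum>x\<in>set_mset M. sum f ((#) x ` permutations_of_multiset (M - {#x#})))"
    unfolding permutations_of_multiset_nonempty[OF assms]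
    by (rule sum.UNION_disjoint) auto
  then show ?thesis
    by (simp add: sum.reindex)
qed

text \<open>Degree \<open>D\<close> is either free or occupied by one element \<open>x\<close> of
  \<open>M\<close>. This recursion carries the induction in the relation below.\<close>

lemma symmetric_multizeta_Suc:
  "symmetric_multizeta S (Suc D) M =
     symmetric_multizeta S D M + (\<Sum>x\<in>set_mset M. S D x * symmetric_multizeta S D (M - {#x#}))"
proof (cases "M = {#}")
  case True
  then show ?thesis by (simp add: symmetric_multizeta_def)
next
  case False
  then show ?thesis
    by (simp add: symmetric_multizeta_def sum_permutations_of_multiset truncated_multizeta_Suc_Cons
          sum.distrib sum_distrib_left)
qed

text \<open>The terms at \<open>(x, y)\<close> and \<open>(y, x)\<close> cancel off the
  diagonal.\<close>

lemma sum_symmetric_char_2: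
  fixes f :: "'b \<Rightarrow> 'b \<Rightarrow> 'a::comm_ring_1"
  assumes "finite X" and char_2: "\<And>x::'a. x + x = 0"
    and "\<And>x y. x \<in> X \<Longrightarrow> y \<in> X \<Longrightarrow> f x y = f y x"
  shows "(\<Sum>x\<in>X. \<Sum>y\<in>X. f x y) = (\<Sum>x\<in>X. f x x)"
  using assms(1,3)
proof (induction X rule: finite_induct)
  case (insert a X)
  have "(\<Sum>x\<in>X. f x a) = (\<Sum>x\<in>X. f a x)"
    by (rule sum.cong) (auto simp: insert.prems)
  then have "(\<Sum>x\<in>insert a X. \<Sum>y\<in>insert a X. f x y) =
      f a a + ((\<Sum>x\<in>X. f a x) + (\<Sum>x\<in>X. f a x)) + (\<Sum>x\<in>X. \<Sum>y\<in>X. f x y)"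
    using insert.hyps by (simp add: sum.distrib algebra_simps)
  moreover have "(\<Sum>x\<in>X. \<Sum>y\<in>X. f x y) = (\<Sum>x\<in>X. f x x)"
    by (rule insert.IH) (simp add: insert.prems)
  ultimately show ?case using insert.hyps by (simp only: char_2 sum.insert) simp
qed simp

lemma in_diff_single_iff: "y \<in># M - {#x#} \<longleftrightarrow> y \<in># M \<and> (x = y \<longrightarrow> 2 \<le> count M y)"
proof (cases "x = y")
  case True
  have "y \<in># M - {#x#} \<longleftrightarrow> 2 \<le> count M y"
    using True by (simp add: in_diff_count) linarith
  moreover have "2 \<le> count M y \<Longrightarrow> y \<in># M"
    by (rule ccontr) (simp add: not_in_iff)
  ultimately show ?thesis using True by blast
qed (simp add: in_diff_count)

text \<open>The range becomes independent of \<open>x\<close> at the price of a condition symmetric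
  in \<open>x\<close> and \<open>y\<close>, so that double sums can be swapped.\<close>

lemma sum_set_mset_diff_single:
  "(\<Sum>y\<in>set_mset (M - {#x#}). f y) =
     (\<Sum>y\<in>set_mset M. if x = y \<longrightarrow> 2 \<le> count M y then f y else 0)"
proof -
  have "set_mset (M - {#x#}) = {y \<in> set_mset M. x = y \<longrightarrow> 2 \<le> count M y}"
    using in_diff_single_iff[of _ M x] by blast
  then show ?thesis by (simp only: sum.inter_filter finite_set_mset)
qed

lemma sum_set_mset_swap:
  "(\<Sum>x\<in>set_mset M. \<Sum>y\<in>set_mset (M - {#x#}). f x y) =
   (\<Sum>y\<in>set_mset M. \<Sum>x\<in>set_mset (M - {#y#}). f x y)"
  unfolding sum_set_mset_diff_single
  by (subst sum.swap) (intro sum.cong refl, auto)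

definition repeated_elements :: "'b multiset \<Rightarrow> 'b set" where
  "repeated_elements M = {x. 2 \<le> count M x}"

lemma repeated_elements_subset: "repeated_elements M \<subseteq> set_mset M"
proof
  fix x assume "x \<in> repeated_elements M"
  then show "x \<in># M"
    by (intro ccontr[of "x \<in># M"]) (simp add: repeated_elements_def not_in_iff)
qed

lemma finite_repeated_elements [simp]: "finite (repeated_elements M)"
  by (rule finite_subset[OF repeated_elements_subset finite_set_mset])

lemma sum_set_mset_pairs_char_2:
  fixes f :: "'b \<Rightarrow> 'b \<Rightarrow> 'a::comm_ring_1"
  assumes "\<And>x::'a. x + x = 0" and "\<And>x y. f x y = f y x"
  shows "(\<Sum>x\<in>set_mset M. \<Sum>y\<in>set_mset (M - {#x#}). f x y) = (\<Sum>x\<in>repeated_elements M. f x x)"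
proof -
  have "(\<Sum>x\<in>set_mset M. \<Sum>y\<in>set_mset (M - {#x#}). f x y) =
      (\<Sum>x\<in>set_mset M. if 2 \<le> count M x then f x x else 0)"
    unfolding sum_set_mset_diff_single
    by (subst sum_symmetric_char_2) (auto simp: assms)
  also have "\<dots> = (\<Sum>x\<in>{x \<in> set_mset M. 2 \<le> count M x}. f x x)"
    by (simp only: sum.inter_filter finite_set_mset)
  also have "{x \<in> set_mset M. 2 \<le> count M x} = repeated_elements M"
    using repeated_elements_subset[of M] by (auto simp: repeated_elements_def)
  finally show ?thesis .
qed

text \<open>Both sides run over the pairs for which \<open>{#x, x, y#}\<close> is contained in
  \<open>M\<close>; \<open>x = y\<close> occurs when the multiplicity is at least 3.\<close>

lemma sum_repeated_elements_swap:
  "(\<Sum>x\<in>repeated_elements M. \<Sum>y\<in>set_mset (M - {#x, x#}). f x y) =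
   (\<Sum>y\<in>set_mset M. \<Sum>x\<in>repeated_elements (M - {#y#}). f x y)"
proof -
  have "(x, y) \<in> (SIGMA x:repeated_elements M. set_mset (M - {#x, x#})) \<longleftrightarrow>
      (y, x) \<in> (SIGMA y:set_mset M. repeated_elements (M - {#y#}))" for x y
    unfolding mem_Sigma_iff count_greater_zero_iff[symmetric] repeated_elements_def mem_Collect_eq
    by (cases "x = y") (auto simp del: count_greater_zero_iff)
  then have "(\<Sum>(x, y)\<in>(SIGMA x:repeated_elements M. set_mset (M - {#x, x#})). f x y) =
      (\<Sum>(y, x)\<in>(SIGMA y:set_mset M. repeated_elements (M - {#y#})). f x y)"
    by (intro sum.reindex_bij_witness[of _ "\<lambda>(y, x). (x, y)" "\<lambda>(x, y). (y, x)"])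
       (auto simp del: mem_Sigma_iff)
  then show ?thesis by (simp add: sum.Sigma)
qed

text \<open>\<open>g\<close> stands for doubling. The induction on \<open>D\<close> treats all
  \<open>M\<close> at once, since the step also uses the relation for each \<open>M - {#y#}\<close>;
  both sides are expanded by \<open>symmetric_multizeta_Suc\<close>. By \<open>new\<close>, the
  added \<open>g x\<close> differs from the remaining elements, so at the new degree the two kinds
  can be told apart.\<close>

lemma symmetric_multizeta_relation:
  fixes S :: "nat \<Rightarrow> 'b \<Rightarrow> 'a::comm_ring_1"
  assumes char_2: "\<And>x::'a. x + x = 0"
    and sq: "\<And>d x. x \<in># M \<Longrightarrow> S d (g x) = S d x * S d x"
    and new: "\<And>x. x \<in> repeated_elements M \<Longrightarrow> g x \<notin># M"
  shows "(\<Sum>x\<in>set_mset M. (\<Sum>d<D. S d x) * symmetric_multizeta S D (M - {#x#})) =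
      of_nat (size M) * symmetric_multizeta S D M +
      (\<Sum>x\<in>repeated_elements M. symmetric_multizeta S D (add_mset (g x) (M - {#x, x#})))"
  using sq new
proof (induction D arbitrary: M)
  case 0
  have "of_nat (size M) * symmetric_multizeta S 0 M = 0"
    by (cases "M = {#}") (auto simp: symmetric_multizeta_0)
  then show ?case by (simp add: symmetric_multizeta_0)
next
  case (Suc D)
  let ?W = "symmetric_multizeta S D"
  let ?p = "\<lambda>x. \<Sum>d<D. S d x"
  let ?L = "\<lambda>M. \<Sum>x\<in>set_mset M. ?p x * ?W (M - {#x#})"
  let ?T = "\<lambda>M. \<Sum>x\<in>repeated_elements M. ?W (add_mset (g x) (M - {#x, x#}))"
  let ?R = "\<lambda>M. of_nat (size M) * ?W M + ?T M"
  define A where "A = (\<Sum>x\<in>set_mset M. S D x * ?W (M - {#x#}))"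
  define C where "C = (\<Sum>x\<in>repeated_elements M. S D x * S D x * ?W (M - {#x, x#}))"
  have IH: "?L M = ?R M" by (rule Suc.IH) (use Suc.prems in auto)
  have IH': "?L (M - {#y#}) = ?R (M - {#y#})" for y
  proof (rule Suc.IH)
    fix x assume "x \<in> repeated_elements (M - {#y#})"
    then have "x \<in> repeated_elements M" by (auto simp: repeated_elements_def)
    from Suc.prems(2)[OF this] show "g x \<notin># M - {#y#}" by (meson in_diffD)
  qed (use Suc.prems(1) in_diffD in fast)
  have comm: "M - {#x#} - {#y#} = M - {#y#} - {#x#}" for x y
    by (simp add: diff_diff_add add_mset_commute)
  \<comment> \<open>The four parts record what sits at degree \<open>D\<close>: nothing, only the
    extra point \<open>x\<close> (this is \<open>A\<close>), only an element \<open>y\<close> of the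
    rest, or both. In the last part exchanging \<open>x\<close> and \<open>y\<close> cancels
    everything except \<open>x = y\<close>, which leaves \<open>C\<close>.\<close>
  have "(\<Sum>x\<in>set_mset M. (\<Sum>d<Suc D. S d x) * symmetric_multizeta S (Suc D) (M - {#x#})) =
      ?L M + A +
      (\<Sum>x\<in>set_mset M. \<Sum>y\<in>set_mset (M - {#x#}). S D y * (?p x * ?W (M - {#x#} - {#y#}))) +
      (\<Sum>x\<in>set_mset M. \<Sum>y\<in>set_mset (M - {#x#}). S D x * S D y * ?W (M - {#x#} - {#y#}))"
    by (simp add: A_def symmetric_multizeta_Suc sum.distrib sum_distrib_left algebra_simps)
  also have "(\<Sum>x\<in>set_mset M. \<Sum>y\<in>set_mset (M - {#x#}). S D y * (?p x * ?W (M - {#x#} - {#y#})))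
      = (\<Sum>y\<in>set_mset M. S D y * ?L (M - {#y#}))"
    by (subst sum_set_mset_swap) (simp add: sum_distrib_left add_mset_commute)
  also have "(\<Sum>x\<in>set_mset M. \<Sum>y\<in>set_mset (M - {#x#}). S D x * S D y * ?W (M - {#x#} - {#y#}))
      = C"
    unfolding C_def
    by (subst sum_set_mset_pairs_char_2)
       (auto simp: char_2 comm mult.commute diff_diff_add add_mset_commute)
  finally have left: "(\<Sum>x\<in>set_mset M. (\<Sum>d<Suc D. S d x) * symmetric_multizeta S (Suc D) (M - {#x#}))
      = ?R M + A + (\<Sum>y\<in>set_mset M. S D y * ?R (M - {#y#})) + C"
    by (simp only: IH IH')
  \<comment> \<open>Degree \<open>D\<close> is free, or carries \<open>g x\<close> and contributes
    the square of \<open>S D x\<close>, or carries an old element \<open>y\<close>.\<close>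
  have step: "symmetric_multizeta S (Suc D) (add_mset (g x) (M - {#x, x#})) =
      ?W (add_mset (g x) (M - {#x, x#})) + S D x * S D x * ?W (M - {#x, x#}) +
      (\<Sum>y\<in>set_mset (M - {#x, x#}). S D y * ?W (add_mset (g x) (M - {#y#} - {#x, x#})))"
    if "x \<in> repeated_elements M" for x
  proof -
    have "g x \<notin># M" by (rule Suc.prems(2)[OF that])
    then have notin: "g x \<notin># M - {#x, x#}" by (meson in_diffD)
    have "S D (g x) = S D x * S D x"
      by (rule Suc.prems(1)) (use repeated_elements_subset that in fast)
    moreover have "add_mset (g x) (M - {#x, x#}) - {#y#} = add_mset (g x) (M - {#y#} - {#x, x#})"
      if "y \<in># M - {#x, x#}" for y
    proof -
      have "y \<noteq> g x" using notin that by blast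
      then show ?thesis by (simp add: diff_diff_add add_mset_commute)
    qed
    ultimately show ?thesis
      using notin by (simp add: symmetric_multizeta_Suc)
  qed
  have "(\<Sum>x\<in>repeated_elements M. symmetric_multizeta S (Suc D) (add_mset (g x) (M - {#x, x#}))) =
      ?T M + C + (\<Sum>x\<in>repeated_elements M. \<Sum>y\<in>set_mset (M - {#x, x#}).
                    S D y * ?W (add_mset (g x) (M - {#y#} - {#x, x#})))"
    by (simp add: step sum.distrib C_def)
  also have "(\<Sum>x\<in>repeated_elements M. \<Sum>y\<in>set_mset (M - {#x, x#}).
                S D y * ?W (add_mset (g x) (M - {#y#} - {#x, x#}))) =
      (\<Sum>y\<in>set_mset M. S D y * ?T (M - {#y#}))"
    by (subst sum_repeated_elements_swap) (simp add: sum_distrib_left)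
  finally have T: "(\<Sum>x\<in>repeated_elements M.
        symmetric_multizeta S (Suc D) (add_mset (g x) (M - {#x, x#}))) =
      ?T M + C + (\<Sum>y\<in>set_mset M. S D y * ?T (M - {#y#}))" .
  \<comment> \<open>\<open>A\<close> contributes one further copy of each
    \<open>?W (M - {#y#})\<close>, which raises the factor \<open>size (M - {#y#})\<close> to
    \<open>size M\<close>.\<close>
  have "A + (\<Sum>y\<in>set_mset M. S D y * ?R (M - {#y#})) =
      (\<Sum>y\<in>set_mset M. S D y * ((1 + of_nat (size (M - {#y#}))) * ?W (M - {#y#}) + ?T (M - {#y#})))"
    by (simp add: A_def sum.distrib algebra_simps)
  also have "\<dots> = (\<Sum>y\<in>set_mset M. S D y * (of_nat (size M) * ?W (M - {#y#}) + ?T (M - {#y#})))"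
  proof (rule sum.cong[OF refl])
    fix y assume "y \<in># M"
    then have "size M = Suc (size (M - {#y#}))" by (metis insert_DiffM size_add_mset)
    then show "S D y * ((1 + of_nat (size (M - {#y#}))) * ?W (M - {#y#}) + ?T (M - {#y#})) =
        S D y * (of_nat (size M) * ?W (M - {#y#}) + ?T (M - {#y#}))" by simp
  qed
  also have "\<dots> = of_nat (size M) * A + (\<Sum>y\<in>set_mset M. S D y * ?T (M - {#y#}))"
    by (simp add: A_def sum.distrib sum_distrib_left algebra_simps)
  finally show ?case
    unfolding left T by (simp add: symmetric_multizeta_Suc A_def[symmetric] algebra_simps)
qed

section \<open>Passage to the limit\<close>

text \<open>Invariance of the metric makes addition continuous: \<open>f x + g x\<close> is moved to
  \<open>a + b\<close> in two steps, one summand at a time.\<close>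

lemma tendsto_add_translation_invariant:
  fixes f g :: "'i \<Rightarrow> 'l::{ab_group_add,metric_space}"
  assumes inv: "\<And>x y z :: 'l. dist (x + z) (y + z) = dist x y"
    and "(f \<longlongrightarrow> a) T" "(g \<longlongrightarrow> b) T"
  shows "((\<lambda>x. f x + g x) \<longlongrightarrow> a + b) T"
proof (rule metric_tendsto_imp_tendsto)
  show "((\<lambda>x. dist (f x) a + dist (g x) b) \<longlongrightarrow> 0) T"
    using tendsto_add[OF assms(2,3)[THEN tendsto_dist_iff[THEN iffD1]]] by simp
  show "\<forall>\<^sub>F x in T. dist (f x + g x) (a + b) \<le> dist (dist (f x) a + dist (g x) b) 0"
  proof (rule always_eventually, rule allI)
    fix x
    have "dist (f x + g x) (a + b) \<le> dist (f x + g x) (a + g x) + dist (a + g x) (a + b)"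
      by (rule dist_triangle)
    also have "dist (a + g x) (a + b) = dist (g x) b"
      using inv[of "g x" a b] by (simp add: add.commute)
    finally show "dist (f x + g x) (a + b) \<le> dist (dist (f x) a + dist (g x) b) 0"
      by (simp add: inv)
  qed
qed

locale valuation_completion = integer_valuation w for w :: "'k::field \<Rightarrow> int" +
  fixes \<iota> :: "'k \<Rightarrow> 'l::{field,complete_space}"
  assumes completion: "is_completion w \<iota>"
begin

lemma embed_one: "\<iota> 1 = 1" and embed_add: "\<iota> (x + y) = \<iota> x + \<iota> y"
  and embed_mult: "\<iota> (x * y) = \<iota> x * \<iota> y"
  and dist_translate: "dist (a + c) (b + c) = dist a (b :: 'l)"
  using completion by (auto simp: is_completion_def)

lemma embed_zero: "\<iota> 0 = 0"
  using embed_add[of 0 0] by (metis add_0 add_cancel_right_right)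

lemma embed_sum: "\<iota> (sum f I) = (\<Sum>i\<in>I. \<iota> (f i))"
  by (induction I rule: infinite_finite_induct) (auto simp: embed_zero embed_add)

lemma embed_prod: "\<iota> (prod f I) = (\<Prod>i\<in>I. \<iota> (f i))"
  by (induction I rule: infinite_finite_induct) (auto simp: embed_one embed_mult)

text \<open>Turns congruences in \<open>K\<close> into distances in the completion, so that
  estimates can be made in \<open>K\<close>: \<open>m\<close> is taken so large that the base
  \<open>c > 1\<close> of the absolute value satisfies \<open>(1 / c) ^ m < e\<close>.\<close>

lemma embed_close:
  assumes "e > 0"
  obtains m :: nat where "\<And>x y. x - y \<in> val_ball (int m) \<Longrightarrow> dist (\<iota> x) (\<iota> y) < e"
proof -
  obtain c :: real where c: "c > 1" "\<And>x. x \<noteq> 0 \<Longrightarrow> dist (\<iota> x) 0 = c powi (- w x)"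
    using completion by (auto simp: is_completion_def)
  obtain m where m: "(1 / c) ^ m < e"
    using real_arch_pow_inv[OF assms, of "1 / c"] c(1) by auto
  have "dist (\<iota> x) (\<iota> y) < e" if "x - y \<in> val_ball (int m)" for x y
  proof -
    have "dist (\<iota> x) (\<iota> y) = dist (\<iota> (x - y)) 0"
      using dist_translate[of "\<iota> (x - y)" "\<iota> y" 0] by (simp flip: embed_add)
    also have "\<dots> < e"
    proof (cases "x - y = 0")
      case False
      then have "dist (\<iota> (x - y)) 0 = c powi (- w (x - y))" by (rule c(2))
      also have "\<dots> \<le> c powi (- int m)"
        using that False c(1) by (intro power_int_increasing) (auto simp: val_ball_def)
      also have "\<dots> = (1 / c) ^ m"
        by (simp add: power_int_minus power_one_over inverse_eq_divide)
      finally show ?thesis using m by simp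
    qed (use assms in \<open>simp add: embed_zero\<close>)
    finally show ?thesis .
  qed
  then show ?thesis by (rule that)
qed

lemma tendsto_zeroI:
  assumes "\<And>m :: nat. \<exists>D0. \<forall>D\<ge>D0. f D \<in> val_ball (int m)"
  shows "(\<lambda>D. \<iota> (f D)) \<longlonglongrightarrow> 0"
proof (rule metric_LIMSEQ_I)
  fix e :: real assume "e > 0"
  then obtain m :: nat where m: "\<And>x y. x - y \<in> val_ball (int m) \<Longrightarrow> dist (\<iota> x) (\<iota> y) < e"
    using embed_close by blast
  have "dist (\<iota> x) 0 < e" if "x \<in> val_ball (int m)" for x
    using m[of x 0] that by (simp add: embed_zero)
  then show "\<exists>no. \<forall>D\<ge>no. dist (\<iota> (f D)) 0 < e"
    using assms[of m] by blast
qed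

lemma tendsto_sum_embed:
  assumes "\<And>i. i \<in> I \<Longrightarrow> (\<lambda>D. \<iota> (f i D)) \<longlonglongrightarrow> L i"
  shows "(\<lambda>D. \<iota> (\<Sum>i\<in>I. f i D)) \<longlonglongrightarrow> sum L I"
  using assms
proof (induction I rule: infinite_finite_induct)
  case (insert i I)
  then have "(\<lambda>D. \<iota> (f i D) + \<iota> (\<Sum>i\<in>I. f i D)) \<longlonglongrightarrow> L i + sum L I"
    by (intro tendsto_add_translation_invariant dist_translate) auto
  then show ?case using insert by (simp add: embed_add)
qed (auto simp: embed_zero)

text \<open>By the ultrametric inequality small terms suffice for summability: enlarging
  \<open>B D\<close> within \<open>X\<close> changes the partial sum by an element of a small ball,
  and completeness supplies the limit. Existence of the sum has to be part of the argument, as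
  \<open>infsum\<close> is 0 by default otherwise.\<close>

lemma tendsto_infsum_embed:
  fixes f :: "'i \<Rightarrow> 'k" and B :: "nat \<Rightarrow> 'i set"
  assumes fin: "\<And>D. finite (B D)" and mono: "mono B" and X: "X = (\<Union>D. B D)"
    and small: "\<And>m :: nat. \<exists>D. \<forall>i\<in>X - B D. f i \<in> val_ball (int m)"
  shows "(\<lambda>D. \<iota> (\<Sum>i\<in>B D. f i)) \<longlonglongrightarrow> (\<Sum>\<^sub>\<infinity>i\<in>X. \<iota> (f i))"
proof -
  let ?s = "\<lambda>Y. \<iota> (\<Sum>i\<in>Y. f i)"
  have close: "\<exists>D. \<forall>Y. finite Y \<and> B D \<subseteq> Y \<and> Y \<subseteq> X \<longrightarrow> dist (?s Y) (?s (B D)) < e"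
    if "e > 0" for e
  proof -
    obtain m :: nat where m: "\<And>x y. x - y \<in> val_ball (int m) \<Longrightarrow> dist (\<iota> x) (\<iota> y) < e"
      using embed_close[OF \<open>e > 0\<close>] by blast
    obtain D where D: "\<forall>i\<in>X - B D. f i \<in> val_ball (int m)" using small by blast
    have "dist (?s Y) (?s (B D)) < e" if "finite Y" "B D \<subseteq> Y" "Y \<subseteq> X" for Y
    proof (rule m)
      have "(\<Sum>i\<in>Y. f i) - (\<Sum>i\<in>B D. f i) = (\<Sum>i\<in>Y - B D. f i)"
        by (rule sum_diff[OF that(1,2), symmetric])
      also have "\<dots> \<in> val_ball (int m)" by (rule val_ball_sum) (use that D in auto)
      finally show "(\<Sum>i\<in>Y. f i) - (\<Sum>i\<in>B D. f i) \<in> val_ball (int m)" .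
    qed
    then show ?thesis by blast
  qed
  have "Cauchy (\<lambda>D. ?s (B D))"
  proof (rule metric_CauchyI)
    fix e :: real assume "e > 0"
    then obtain D where D: "\<And>Y. finite Y \<Longrightarrow> B D \<subseteq> Y \<Longrightarrow> Y \<subseteq> X \<Longrightarrow> dist (?s Y) (?s (B D)) < e / 2"
      using close[of "e / 2"] by auto
    have "dist (?s (B D')) (?s (B D)) < e / 2" if "D' \<ge> D" for D'
      using that by (intro D fin monoD[OF mono]) (auto simp: X)
    then show "\<exists>M. \<forall>m\<ge>M. \<forall>n\<ge>M. dist (?s (B m)) (?s (B n)) < e"
      using dist_triangle_half_l by (metis dist_commute)
  qed
  then obtain L where L: "(\<lambda>D. ?s (B D)) \<longlonglongrightarrow> L"
    using Cauchy_convergent convergent_def by blast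
  have "((\<lambda>i. \<iota> (f i)) has_sum L) X"
    unfolding has_sum_def tendsto_iff
  proof (intro allI impI)
    fix e :: real assume "e > 0"
    then obtain D where D: "\<And>Y. finite Y \<Longrightarrow> B D \<subseteq> Y \<Longrightarrow> Y \<subseteq> X \<Longrightarrow> dist (?s Y) (?s (B D)) < e / 4"
      using close[of "e / 4"] by auto
    have "e / 4 > 0" using \<open>e > 0\<close> by simp
    then obtain D' where D': "\<And>n. n \<ge> D' \<Longrightarrow> dist (?s (B n)) L < e / 4"
      using metric_LIMSEQ_D[OF L] by blast
    \<comment> \<open>At the index \<open>max D D'\<close> the closeness to \<open>?s (B D)\<close>
      and the closeness to \<open>L\<close> are both available.\<close>
    have "dist (?s (B (max D D'))) (?s (B D)) < e / 4"
      by (intro D fin monoD[OF mono]) (auto simp: X)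
    moreover have "dist (?s (B (max D D'))) L < e / 4" by (rule D') simp
    ultimately have BL: "dist (?s (B D)) L < e / 2"
      using dist_triangle3[of "?s (B D)" L "?s (B (max D D'))"] by simp
    have "dist (\<Sum>i\<in>Y. \<iota> (f i)) L < e" if "finite Y" "B D \<subseteq> Y" "Y \<subseteq> X" for Y
      using D[OF that] BL dist_triangle[of "?s Y" L "?s (B D)"] \<open>e > 0\<close>
      by (simp add: embed_sum)
    then show "\<forall>\<^sub>F Y in finite_subsets_at_top X. dist (\<Sum>i\<in>Y. \<iota> (f i)) L < e"
      unfolding eventually_finite_subsets_at_top using fin X by blast
  qed
  then show ?thesis using L infsumI by metis
qed

end

section \<open>Multizeta values in the completion at \<open>v\<close>\<close>

locale v_adic_multizeta =
  coprime_power_sums F R w \<kappa> sg v u + v: valuation_completion u \<iota>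
  for F :: "'k::field set" and R w and \<kappa> :: "'k \<Rightarrow> 'm::field" and sg v u
    and \<iota> :: "'k \<Rightarrow> 'l::{field,complete_space}"
begin

abbreviation q_even :: "int \<Rightarrow> bool" where "q_even s \<equiv> (int (card F) - 1) dvd s"

lemma S_small:
  assumes "q_even s"
  shows "\<exists>D0. \<forall>d\<ge>D0. S d s \<in> u.val_ball (int m)"
proof -
  obtain D0 where D0: "\<And>D. D \<ge> D0 \<Longrightarrow> (\<Sum>d<D. S d s) \<in> u.val_ball (int m)"
    using sum_S_small[OF assms] by blast
  have "S d s \<in> u.val_ball (int m)" if "d \<ge> D0" for d
    using u.val_ball_diff[OF D0[of "Suc d"] D0[of d]] that by simp
  then show ?thesis by blast
qed

text \<open>A decreasing list not bounded by \<open>D\<close> has first entry at least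
  \<open>D\<close>, so its first factor is small by \<open>S_small\<close>, while the other factors
  are integral at \<open>v\<close>.\<close>

lemma truncated_multizeta_tendsto:
  assumes "\<And>s. s \<in> set t \<Longrightarrow> q_even s"
  shows "(\<lambda>D. \<iota> (truncated_multizeta S D t)) \<longlonglongrightarrow> multizeta \<iota> S t"
proof -
  let ?X = "{d. length d = length t \<and> sorted_wrt (>) d}"
  have "(\<lambda>D. \<iota> (\<Sum>d\<in>decreasing_lists (length t) D. \<Prod>j<length t. S (d ! j) (t ! j)))
      \<longlonglongrightarrow> (\<Sum>\<^sub>\<infinity>d\<in>?X. \<iota> (\<Prod>j<length t. S (d ! j) (t ! j)))"
  proof (rule v.tendsto_infsum_embed)
    show "mono (decreasing_lists (length t))"
      by (fastforce simp: mono_def decreasing_lists_def)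
    show "?X = (\<Union>D. decreasing_lists (length t) D)"
    proof -
      have "\<exists>D. set d \<subseteq> {..<D}" for d :: "nat list"
        using finite_nat_set_iff_bounded[of "set d"] by auto
      then show ?thesis by (auto simp: decreasing_lists_def)
    qed
    fix m :: nat
    show "\<exists>D. \<forall>d\<in>?X - decreasing_lists (length t) D.
        (\<Prod>j<length t. S (d ! j) (t ! j)) \<in> u.val_ball (int m)"
    proof (cases t)
      case Nil
      then show ?thesis by auto
    next
      case (Cons s t')
      then obtain D where D: "\<And>d. d \<ge> D \<Longrightarrow> S d s \<in> u.val_ball (int m)"
        using S_small[of s m] assms by auto
      have "(\<Prod>j<length t. S (d ! j) (t ! j)) \<in> u.val_ball (int m)"
        if d_in: "d \<in> ?X - decreasing_lists (length t) D" for d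
      proof -
        obtain a d' where d: "d = a # d'" using d_in Cons by (cases d) auto
        have "D \<le> a"
        proof (rule ccontr)
          assume "\<not> D \<le> a"
          then have "set d \<subseteq> {..<D}" using that d by auto
          then show False using that by (auto simp: decreasing_lists_def)
        qed
        have "S a s * (\<Prod>j<length t'. S (d' ! j) (t' ! j)) \<in> u.val_ball (int m + 0)"
          by (intro u.val_ball_mult D u.val_ball_prod S_integral \<open>D \<le> a\<close>)
        then show ?thesis
          by (simp add: Cons d prod.lessThan_Suc_shift del: prod.lessThan_Suc)
      qed
      then show ?thesis by blast
    qed
  qed simp
  then show ?thesis by (simp add: truncated_multizeta_def multizeta_def v.embed_prod)
qed

lemma symmetric_multizeta_tendsto:
  assumes "\<And>s. s \<in># mset t \<Longrightarrow> q_even s"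
  shows "(\<lambda>D. \<iota> (symmetric_multizeta S D (mset t))) \<longlonglongrightarrow> (\<Sum>t\<in>reorderings t. multizeta \<iota> S t)"
  unfolding symmetric_multizeta_def reorderings_def
  by (intro v.tendsto_sum_embed truncated_multizeta_tendsto assms)
     (auto simp: permutations_of_multiset_def simp flip: set_mset_mset)

lemma symmetric_multizeta_integral: "symmetric_multizeta S D M \<in> u.val_ball 0"
  unfolding symmetric_multizeta_def truncated_multizeta_def
  by (intro u.val_ball_sum u.val_ball_prod S_integral)

text \<open>\<open>U D\<close> is the left side truncated to degrees below \<open>D\<close>, and
  tends to it term by term. By the combinatorial relation it is also a combination, with integral
  coefficients, of the partial sums of \<open>S d s\<close>, so it tends to 0. The list
  \<open>r s\<close> is prescribed only as a multiset because just its reorderings enter.\<close>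

lemma symmetric_multizeta_relation_limit:
  fixes t :: "int list" and r :: "int \<Rightarrow> int list"
  assumes even: "\<And>s. s \<in> set t \<Longrightarrow> q_even s"
    and new: "\<And>s. s \<in> repeated_elements (mset t) \<Longrightarrow> 2 * s \<notin> set t"
    and r: "\<And>s. s \<in> repeated_elements (mset t) \<Longrightarrow> mset (r s) = add_mset (2 * s) (mset t - {#s, s#})"
  shows "(\<Sum>s\<in>repeated_elements (mset t). \<Sum>t'\<in>reorderings (r s). multizeta \<iota> S t') +
      of_nat (length t) * (\<Sum>t'\<in>reorderings t. multizeta \<iota> S t') = 0"
proof -
  let ?M = "mset t"
  let ?E = "repeated_elements ?M"
  let ?W = "symmetric_multizeta S"
  \<comment> \<open>The factor \<open>length t\<close> is written as a repeated sum, so that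
    continuity of addition also covers this term.\<close>
  define U where "U D = (\<Sum>s\<in>?E. ?W D (mset (r s))) + (\<Sum>i<length t. ?W D ?M)" for D
  have E_sub: "s \<in> set t" if "s \<in> ?E" for s
    using repeated_elements_subset[of ?M] that by auto
  have "(\<lambda>D. \<iota> (\<Sum>s\<in>?E. ?W D (mset (r s)))) \<longlonglongrightarrow>
      (\<Sum>s\<in>?E. \<Sum>t'\<in>reorderings (r s). multizeta \<iota> S t')"
  proof (intro v.tendsto_sum_embed symmetric_multizeta_tendsto)
    fix s x assume s: "s \<in> ?E" and x: "x \<in># mset (r s)"
    then have "x = 2 * s \<or> x \<in> set t" by (auto simp: r dest: in_diffD)
    then show "q_even x" using even E_sub[OF s] by auto
  qed
  moreover have "(\<lambda>D. \<iota> (\<Sum>i<length t. ?W D ?M)) \<longlonglongrightarrow>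
      (\<Sum>i<length t. \<Sum>t'\<in>reorderings t. multizeta \<iota> S t')"
    by (intro v.tendsto_sum_embed symmetric_multizeta_tendsto) (simp add: even)
  ultimately have lim: "(\<lambda>D. \<iota> (U D)) \<longlonglongrightarrow>
      (\<Sum>s\<in>?E. \<Sum>t'\<in>reorderings (r s). multizeta \<iota> S t') +
      (\<Sum>i<length t. \<Sum>t'\<in>reorderings t. multizeta \<iota> S t')"
    unfolding U_def v.embed_add
    by (rule tendsto_add_translation_invariant[OF v.dist_translate])
  have U_eq: "U D = (\<Sum>s\<in>set t. (\<Sum>d<D. S d s) * ?W D (?M - {#s#}))" for D
    using symmetric_multizeta_relation[of ?M S "\<lambda>s. 2 * s" D, OF char_2 S_double] new
    by (simp add: U_def r)
  have "(\<lambda>D. \<iota> (U D)) \<longlonglongrightarrow> 0"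
  proof (rule v.tendsto_zeroI)
    fix m :: nat
    have "\<forall>\<^sub>F D in sequentially. \<forall>s\<in>set t. (\<Sum>d<D. S d s) \<in> u.val_ball (int m)"
      by (rule eventually_ball_finite) (auto simp: eventually_sequentially sum_S_small even)
    then obtain D0 where D0: "\<And>D s. D \<ge> D0 \<Longrightarrow> s \<in> set t \<Longrightarrow> (\<Sum>d<D. S d s) \<in> u.val_ball (int m)"
      by (auto simp: eventually_sequentially)
    have "U D \<in> u.val_ball (int m)" if "D \<ge> D0" for D
      unfolding U_eq
    proof (rule u.val_ball_sum)
      fix s assume "s \<in> set t"
      from u.val_ball_mult[OF D0[OF that this] symmetric_multizeta_integral]
      show "(\<Sum>d<D. S d s) * ?W D (?M - {#s#}) \<in> u.val_ball (int m)" by simp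
    qed
    then show "\<exists>D0. \<forall>D\<ge>D0. U D \<in> u.val_ball (int m)" by blast
  qed
  from LIMSEQ_unique[OF lim this] show ?thesis by simp
qed

end

section \<open>The tuples of the theorem as multisets\<close>

lemma mset_base_tuple: "mset (base_tuple n k s) = (\<Sum>j=1..n. replicate_mset (k j) (s j))"
  by (simp add: base_tuple_def mset_concat sum_list_distinct_conv_sum_set comp_def
        atLeastLessThanSuc_atLeastAtMost del: upt_Suc)

lemma mset_merged_tuple:
  assumes "i \<in> {1..n}" "k i > 1"
  shows "mset (merged_tuple n k s i) =
           add_mset (2 * s i) (mset (base_tuple n k s) - {#s i, s i#})"
proof -
  let ?rest = "\<Sum>j\<in>{1..n} - {i}. replicate_mset (k j) (s j)"
  have "mset (merged_tuple n k s i) = (\<Sum>j=1..n. if j = i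
      then replicate_mset (k j - 2) (s j) + {#2 * s j#} else replicate_mset (k j) (s j))"
    by (simp add: merged_tuple_def mset_concat sum_list_distinct_conv_sum_set comp_def
        atLeastLessThanSuc_atLeastAtMost if_distrib[of mset] del: upt_Suc cong: if_cong)
  also have "\<dots> = add_mset (2 * s i) (replicate_mset (k i - 2) (s i) + ?rest)"
    using assms(1) by (simp add: sum.remove[of _ i])
  finally have merged: "mset (merged_tuple n k s i) =
      add_mset (2 * s i) (replicate_mset (k i - 2) (s i) + ?rest)" .
  \<comment> \<open>This form of \<open>k i\<close> resolves the truncated difference
    \<open>k i - 2\<close>.\<close>
  obtain l where "k i = Suc (Suc l)" using assms(2) by (metis less_iff_Suc_add add_Suc plus_1_eq_Suc)
  moreover have "mset (base_tuple n k s) = replicate_mset (k i) (s i) + ?rest"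
    using assms(1) by (simp add: mset_base_tuple sum.remove[of _ i])
  ultimately show ?thesis by (simp add: merged)
qed

lemma count_base_tuple:
  assumes "inj_on s {1..n}" "i \<in> {1..n}"
  shows "count (mset (base_tuple n k s)) (s i) = k i"
proof -
  have "count (mset (base_tuple n k s)) (s i) = (\<Sum>j=1..n. if j = i then k j else 0)"
    unfolding mset_base_tuple count_sum
  proof (rule sum.cong[OF refl])
    fix j assume "j \<in> {1..n}"
    then have "s j = s i \<longleftrightarrow> j = i" using inj_on_eq_iff[OF assms(1)] assms(2) by blast
    then show "count (replicate_mset (k j) (s j)) (s i) = (if j = i then k j else 0)" by auto
  qed
  then show ?thesis using assms by simp
qed

theorem theorem2p2:
  fixes F :: "'k::field set" and q :: nat
    and R_inf :: "'k set" and ord_inf :: "'k \<Rightarrow> int"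
    and \<iota>_inf :: "'k \<Rightarrow> 'm::{field,complete_space}" and sg :: "'m \<Rightarrow> 'k"
    and A :: "'k set" and v :: 'k
    and ord_v :: "'k \<Rightarrow> int" and \<iota>_v :: "'k \<Rightarrow> 'l::{field,complete_space}"
    and n :: nat and k :: "nat \<Rightarrow> nat" and s :: "nat \<Rightarrow> int"
    and \<phi> :: nat and \<zeta>_v :: "int list \<Rightarrow> 'l"
  assumes "function_field F" and "finite F" and "card F = q" and "CHAR('k) = 2"
    and "rational_place F R_inf"
    and "normalized_valuation R_inf ord_inf"
    and "is_completion ord_inf \<iota>_inf"
    and "sign_function F \<iota>_inf sg"
    and "A = regular_outside F R_inf"
    and "prime_in A v" and "monic_elt \<iota>_inf sg v"
    and "normalized_valuation (localization_at A v) ord_v"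
    and "is_completion ord_v \<iota>_v"
    and "\<zeta>_v = multizeta \<iota>_v (S_tilde A ord_inf \<iota>_inf sg v)"
    and "n \<ge> 1"
    and "\<forall>i\<in>{1..n}. k i \<ge> 1"
    and "\<forall>i\<in>{1..n}. (int q - 1) dvd s i"
    and "distinct (map s [1..<Suc n] @ map (\<lambda>i. 2 * s i) (filter (\<lambda>i. k i > 1) [1..<Suc n]))"
    and "\<phi> = (\<Sum>i=1..n. k i)"
  shows "(\<Sum>i\<in>{i\<in>{1..n}. k i > 1}. \<Sum>t\<in>reorderings (merged_tuple n k s i). \<zeta>_v t)
           + of_nat \<phi> * (\<Sum>t\<in>reorderings (base_tuple n k s). \<zeta>_v t) = 0"
proof -
  have char_2: "x + x = 0" for x :: 'k
  proof -
    have "(of_nat 2 :: 'k) = 0" using of_nat_CHAR[where 'a = 'k] assms(4) by simp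
    then have "(2 :: 'k) = 0" by simp
    then show ?thesis by (metis mult_2 mult_zero_left)
  qed
  interpret v_adic_multizeta F R_inf ord_inf \<iota>_inf sg v ord_v \<iota>_v
  proof unfold_locales
    show "is_subfield F" using assms(1) by (simp add: function_field_def)
    show "\<iota>_inf 1 = 1" "\<And>x y. \<iota>_inf (x * y) = \<iota>_inf x * \<iota>_inf y"
      using assms(7) by (auto simp: is_completion_def)
  qed (use assms char_2 integer_valuation.val_mult[OF integer_valuation_if_normalized[OF assms(12)]]
        integer_valuation.val_add[OF integer_valuation_if_normalized[OF assms(12)]] in auto)
  let ?t = "base_tuple n k s"
  let ?I = "{i \<in> {1..n}. k i > 1}"
  have s_inj: "inj_on s {1..n}" and s_new: "\<And>i j. i \<in> ?I \<Longrightarrow> j \<in> {1..n} \<Longrightarrow> 2 * s i \<noteq> s j"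
    using assms(18) by (fastforce simp: distinct_map atLeastLessThanSuc_atLeastAtMost simp del: upt_Suc)+
  \<comment> \<open>Each \<open>s i\<close> does occur, because \<open>k i \<ge> 1\<close>.\<close>
  have set_t: "set ?t = s ` {1..n}"
    using assms(16) by (force simp: base_tuple_def simp del: upt_Suc)
  \<comment> \<open>As \<open>s\<close> is injective, the multiplicity of \<open>s i\<close> is
    exactly \<open>k i\<close>.\<close>
  have rep: "repeated_elements (mset ?t) = s ` ?I"
  proof (intro equalityI subsetI)
    fix x assume x: "x \<in> repeated_elements (mset ?t)"
    then have "x \<in> s ` {1..n}" using repeated_elements_subset[of "mset ?t"] set_t by auto
    then show "x \<in> s ` ?I" using x count_base_tuple[OF s_inj, of _ k] by (auto simp: repeated_elements_def)
  next
    fix x assume "x \<in> s ` ?I"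
    then show "x \<in> repeated_elements (mset ?t)"
      using count_base_tuple[OF s_inj, of _ k] by (auto simp: repeated_elements_def)
  qed
  have inj: "inj_on s ?I" using s_inj by (rule inj_on_subset) auto
  have inv: "inv_into {1..n} s (s i) = i" if "i \<in> ?I" for i
    using s_inj that by (auto intro: inv_into_f_f)
  have len: "length ?t = \<phi>"
    by (simp add: assms(19) mset_base_tuple flip: size_mset)
  \<comment> \<open>The general relation is indexed by the repeated values \<open>x\<close>;
    \<open>inv_into\<close> recovers the index \<open>i\<close> from \<open>x = s i\<close>.\<close>
  have "(\<Sum>x\<in>s ` ?I. \<Sum>t\<in>reorderings (merged_tuple n k s (inv_into {1..n} s x)). \<zeta>_v t) +
      of_nat (length ?t) * (\<Sum>t\<in>reorderings ?t. \<zeta>_v t) = 0"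
    unfolding rep[symmetric] assms(9,14)
  proof (rule symmetric_multizeta_relation_limit)
    show "q_even x" if "x \<in> set ?t" for x using assms(3,17) that by (auto simp: set_t)
    show "2 * x \<notin> set ?t" if "x \<in> repeated_elements (mset ?t)" for x
      using that s_new by (auto simp: rep set_t)
    show "mset (merged_tuple n k s (inv_into {1..n} s x)) = add_mset (2 * x) (mset ?t - {#x, x#})"
      if "x \<in> repeated_elements (mset ?t)" for x
      using that mset_merged_tuple[of _ n k s] inv by (auto simp: rep)
  qed
  moreover have "(\<Sum>x\<in>s ` ?I. \<Sum>t\<in>reorderings (merged_tuple n k s (inv_into {1..n} s x)). \<zeta>_v t) =
      (\<Sum>i\<in>?I. \<Sum>t\<in>reorderings (merged_tuple n k s i). \<zeta>_v t)"
    unfolding sum.reindex[OF inj] comp_def by (rule sum.cong[OF refl]) (simp only: inv)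
  ultimately show ?thesis by (simp only: len)
qed

end
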